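(* Let $VB_n$ be the virtual braid group on $n$ strands, $VB_n'=[VB_n,VB_n]$ and $VB_n''=[VB_n',VB_n']$. Then: (1) $VB_3'/VB_3''\cong \mathbb{Z}_3\oplus\mathbb{Z}_3\oplus\mathbb{Z}_3\oplus\mathbb{Z}^{\infty}$; (2) $VB_4'/VB_4''\cong \mathbb{Z}_3\oplus\mathbb{Z}_3\oplus\mathbb{Z}_3$; (3) for every $n\ge 5$ the group $VB_n'$ is perfect, i.e. $VB_n'=VB_n''$.
   Context: The virtual braid group $VB_n$ is the group with generators $\sigma_1,\dots,\sigma_{n-1},\rho_1,\dots,\rho_{n-1}$ and defining relations: $\sigma_i\sigma_j=\sigma_j\sigma_i$ for $|i-j|\ge 2$; $\sigma_i\sigma_{i+1}\sigma_i=\sigma_{i+1}\sigma_i\sigma_{i+1}$ for $1\le i\le n-2$; $\rho_i^2=1$ for $1\le i\le n-1$; $\rho_i\rho_j=\rho_j\rho_i$ for $|i-j|\ge 2$; $\rho_i\rho_{i+1}\rho_i=\rho_{i+1}\rho_i\rho_{i+1}$ for $1\le i\le n-2$; $\sigma_i\rho_j=\rho_j\sigma_i$ for $|i-j|\ge 2$; $\rho_i\rho_{i+1}\sigma_i=\sigma_{i+1}\rho_i\rho_{i+1}$ for $1\le i\le n-2$. Here $\mathbb{Z}_3$ is the cyclic group of order $3$ and $\mathbb{Z}^{\infty}$ denotes the direct sum of countably infinitely many copies of $\mathbb{Z}$ (the free abelian group of countably infinite rank). *)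

theory Defs
  imports "HOL-Algebra.Algebra"
begin

section \<open>Groups given by generators and relations\<close>

text \<open>A letter is a pair \<open>(x, e)\<close>: \<open>(x, True)\<close> stands for the generator \<open>x\<close> and \<open>(x, False)\<close>
  for its formal inverse.  A relation \<open>l = r\<close> is represented by the pair of words \<open>(l, r)\<close>.\<close>

type_synonym 'g word = "('g \<times> bool) list"

definition words :: "'g set \<Rightarrow> 'g word set" where
  "words S = lists (S \<times> UNIV)"

inductive_set pres_rel :: "'g set \<Rightarrow> ('g word \<times> 'g word) set \<Rightarrow> ('g word \<times> 'g word) set"
  for S R where
  refl: "w \<in> words S \<Longrightarrow> (w, w) \<in> pres_rel S R"
| sym: "(u, v) \<in> pres_rel S R \<Longrightarrow> (v, u) \<in> pres_rel S R"
| trans: "(u, v) \<in> pres_rel S R \<Longrightarrow> (v, w) \<in> pres_rel S R \<Longrightarrow> (u, w) \<in> pres_rel S R"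
| cancel: "u \<in> words S \<Longrightarrow> v \<in> words S \<Longrightarrow> x \<in> S \<Longrightarrow>
    (u @ [(x, e), (x, \<not> e)] @ v, u @ v) \<in> pres_rel S R"
| rel: "(l, r) \<in> R \<Longrightarrow> u \<in> words S \<Longrightarrow> v \<in> words S \<Longrightarrow> l \<in> words S \<Longrightarrow> r \<in> words S \<Longrightarrow>
    (u @ l @ v, u @ r @ v) \<in> pres_rel S R"

definition presented_group :: "'g set \<Rightarrow> ('g word \<times> 'g word) set \<Rightarrow> 'g word set monoid" where
  "presented_group S R =
    \<lparr>carrier = words S // pres_rel S R,
     monoid.mult = (\<lambda>A B. \<Union>a\<in>A. \<Union>b\<in>B. pres_rel S R `` {a @ b}),
     one = pres_rel S R `` {[]}\<rparr>"

lemma words_simps [simp]: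
  "[] \<in> words S"
  "u @ v \<in> words S \<longleftrightarrow> u \<in> words S \<and> v \<in> words S"
  "p # v \<in> words S \<longleftrightarrow> fst p \<in> S \<and> v \<in> words S"
  by (auto simp: words_def mem_Times_iff)

lemma pres_rel_in_words:
  "(u, v) \<in> pres_rel S R \<Longrightarrow> u \<in> words S \<and> v \<in> words S"
  by (induction rule: pres_rel.induct) auto

lemma equiv_pres_rel: "equiv (words S) (pres_rel S R)"
  by (rule equivI) (auto simp: refl_on_def sym_def trans_def dest: pres_rel_in_words
      intro: pres_rel.refl pres_rel.sym pres_rel.trans)

lemma pres_rel_context:
  assumes "(u, v) \<in> pres_rel S R" and w: "w \<in> words S" "w' \<in> words S"
  shows "(w @ u @ w', w @ v @ w') \<in> pres_rel S R"
  using assms(1)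
proof (induction rule: pres_rel.induct)
  case (refl u)
  with w show ?case by (auto intro: pres_rel.refl)
next
  case (sym u v)
  then show ?case by (blast intro: pres_rel.sym)
next
  case (trans u v x)
  then show ?case by (blast intro: pres_rel.trans)
next
  case (cancel u v x e)
  with w show ?case
    using pres_rel.cancel[of "w @ u" S "v @ w'" x e R] by simp
next
  case (rel l r u v)
  with w show ?case
    using pres_rel.rel[of l r R "w @ u" S "v @ w'"] by simp
qed

lemma pres_rel_append:
  assumes a: "(a, a') \<in> pres_rel S R" and b: "(b, b') \<in> pres_rel S R"
  shows "(a @ b, a' @ b') \<in> pres_rel S R"
proof (rule pres_rel.trans)
  show "(a @ b, a' @ b) \<in> pres_rel S R"
    using pres_rel_context[OF a, of "[]" b] pres_rel_in_words[OF b] by simp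
  show "(a' @ b, a' @ b') \<in> pres_rel S R"
    using pres_rel_context[OF b, of a' "[]"] pres_rel_in_words[OF a] by simp
qed

lemma presented_group_mult_class:
  assumes "a \<in> words S" "b \<in> words S"
  shows "pres_rel S R `` {a} \<otimes>\<^bsub>presented_group S R\<^esub> pres_rel S R `` {b} = pres_rel S R `` {a @ b}"
  unfolding presented_group_def monoid.simps
  by (rule UN_equiv_class2[OF equiv_pres_rel equiv_pres_rel _ assms])
     (auto simp: congruent2_def intro!: equiv_class_eq[OF equiv_pres_rel] pres_rel_append)

lemma pres_rel_inverse:
  assumes "w \<in> words S"
  shows "(rev (map (\<lambda>(x, e). (x, \<not> e)) w) @ w, []) \<in> pres_rel S R"
  using assms
proof (induction w)
  case Nil
  then show ?case by (simp add: pres_rel.refl)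
next
  case (Cons p w)
  obtain x e where p: "p = (x, e)" by fastforce
  let ?v = "rev (map (\<lambda>(x, e). (x, \<not> e)) w)"
  have v: "?v \<in> words S"
    using Cons.prems by (auto simp: words_def)
  have "(?v @ [(x, \<not> e), (x, \<not> \<not> e)] @ w, ?v @ w) \<in> pres_rel S R"
    using Cons.prems p v by (intro pres_rel.cancel) auto
  moreover have "(?v @ w, []) \<in> pres_rel S R"
    using Cons by simp
  ultimately show ?case
    using p by (auto intro: pres_rel.trans)
qed

lemma group_presented_group: "group (presented_group S R)"
proof (rule groupI)
  let ?P = "presented_group S R"
  have carr: "carrier ?P = words S // pres_rel S R"
    and one: "\<one>\<^bsub>?P\<^esub> = pres_rel S R `` {[]}"
    by (simp_all add: presented_group_def)
  note [simp] = carr one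
  show "\<one>\<^bsub>?P\<^esub> \<in> carrier ?P"
    by (auto intro: quotientI)
  fix x assume "x \<in> carrier ?P"
  then obtain a where a: "a \<in> words S" "x = pres_rel S R `` {a}"
    by (auto elim: quotientE)
  show "\<one>\<^bsub>?P\<^esub> \<otimes>\<^bsub>?P\<^esub> x = x"
    using a by (simp add: presented_group_mult_class)
  let ?i = "rev (map (\<lambda>(x, e). (x, \<not> e)) a)"
  have i: "?i \<in> words S"
    using a(1) by (auto simp: words_def)
  have "pres_rel S R `` {?i} \<otimes>\<^bsub>?P\<^esub> x = \<one>\<^bsub>?P\<^esub>"
    using a i pres_rel_inverse[OF a(1), of R]
    by (simp add: presented_group_mult_class equiv_class_eq[OF equiv_pres_rel])
  then show "\<exists>y\<in>carrier ?P. y \<otimes>\<^bsub>?P\<^esub> x = \<one>\<^bsub>?P\<^esub>"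
    using i by (auto intro: quotientI)
  fix y assume "y \<in> carrier ?P"
  then obtain b where b: "b \<in> words S" "y = pres_rel S R `` {b}"
    by (auto elim: quotientE)
  show "x \<otimes>\<^bsub>?P\<^esub> y \<in> carrier ?P"
    using a b by (auto simp: presented_group_mult_class intro: quotientI)
  fix z assume "z \<in> carrier ?P"
  then obtain c where c: "c \<in> words S" "z = pres_rel S R `` {c}"
    by (auto elim: quotientE)
  show "x \<otimes>\<^bsub>?P\<^esub> y \<otimes>\<^bsub>?P\<^esub> z = x \<otimes>\<^bsub>?P\<^esub> (y \<otimes>\<^bsub>?P\<^esub> z)"
    using a b c by (simp add: presented_group_mult_class)
qed


section \<open>The virtual braid groups\<close>

datatype vb_gen = Sigma nat | Rho nat

abbreviation sg :: "nat \<Rightarrow> vb_gen \<times> bool" where "sg i \<equiv> (Sigma i, True)"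
abbreviation rh :: "nat \<Rightarrow> vb_gen \<times> bool" where "rh i \<equiv> (Rho i, True)"

definition VB_gens :: "nat \<Rightarrow> vb_gen set" where
  "VB_gens n = Sigma ` {1..n-1} \<union> Rho ` {1..n-1}"

definition far :: "nat \<Rightarrow> nat \<Rightarrow> bool" where
  "far i j \<longleftrightarrow> \<bar>int i - int j\<bar> \<ge> 2"

inductive_set VB_rels :: "nat \<Rightarrow> (vb_gen word \<times> vb_gen word) set" for n where
  sigma_far: "i \<in> {1..n-1} \<Longrightarrow> j \<in> {1..n-1} \<Longrightarrow> far i j \<Longrightarrow>
    ([sg i, sg j], [sg j, sg i]) \<in> VB_rels n"
| sigma_braid: "i \<in> {1..n-2} \<Longrightarrow>
    ([sg i, sg (i+1), sg i], [sg (i+1), sg i, sg (i+1)]) \<in> VB_rels n"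
| rho_square: "i \<in> {1..n-1} \<Longrightarrow> ([rh i, rh i], []) \<in> VB_rels n"
| rho_far: "i \<in> {1..n-1} \<Longrightarrow> j \<in> {1..n-1} \<Longrightarrow> far i j \<Longrightarrow>
    ([rh i, rh j], [rh j, rh i]) \<in> VB_rels n"
| rho_braid: "i \<in> {1..n-2} \<Longrightarrow>
    ([rh i, rh (i+1), rh i], [rh (i+1), rh i, rh (i+1)]) \<in> VB_rels n"
| mixed_far: "i \<in> {1..n-1} \<Longrightarrow> j \<in> {1..n-1} \<Longrightarrow> far i j \<Longrightarrow>
    ([sg i, rh j], [rh j, sg i]) \<in> VB_rels n"
| mixed_braid: "i \<in> {1..n-2} \<Longrightarrow>
    ([rh i, rh (i+1), sg i], [sg (i+1), rh i, rh (i+1)]) \<in> VB_rels n"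

definition VB :: "nat \<Rightarrow> vb_gen word set monoid" where
  "VB n = presented_group (VB_gens n) (VB_rels n)"

lemma group_VB: "group (VB n)"
  by (simp add: VB_def group_presented_group)

text \<open>The subgroups \<open>VB\<^sub>n'\<close> and \<open>VB\<^sub>n''\<close>, as sets of elements of \<open>VB\<^sub>n\<close>, and the quotient
  \<open>VB\<^sub>n' / VB\<^sub>n''\<close>.\<close>

definition VB_derived :: "nat \<Rightarrow> vb_gen word set set" where
  "VB_derived n = derived (VB n) (carrier (VB n))"

definition VB_derived2 :: "nat \<Rightarrow> vb_gen word set set" where
  "VB_derived2 n = derived (VB n) (VB_derived n)"

definition VB_derived_quot :: "nat \<Rightarrow> vb_gen word set set monoid" where
  "VB_derived_quot n = (VB n)\<lparr>carrier := VB_derived n\<rparr> Mod VB_derived2 n"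

abbreviation Z3 :: "int monoid" where
  "Z3 \<equiv> integer_mod_group 3"

text \<open>The elements of \<open>sum_group\<close> are the families of finite support, so this is the direct sum
  of countably many copies of the integers.\<close>

definition Z_infinity :: "(nat \<Rightarrow> int) monoid" where
  "Z_infinity = sum_group (UNIV :: nat set) (\<lambda>_. integer_group)"

end

theory Submission
  imports Defs "HOL-Library.Numeral_Type"
begin

text \<open>Put \<open>Q = VB\<^sub>n / VB\<^sub>n''\<close>, so that \<open>VB\<^sub>n' / VB\<^sub>n'' = Q'\<close> is abelian, and let \<open>s\<close>, \<open>r\<close>, \<open>c\<close> be the
  images of \<open>\<sigma>\<^sub>1\<close>, \<open>\<rho>\<^sub>1\<close>, \<open>\<rho>\<^sub>1\<rho>\<^sub>2\<close>.  For \<open>n = 3\<close> these generate \<open>Q\<close>, and \<open>Q'\<close> is generated by the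
  conjugates of \<open>c\<close> and of \<open>d = [s, r]\<close> by the powers of \<open>s\<close>.  The element \<open>c\<close> has order three and
  the braid relation becomes the recurrence \<open>c\<^sub>3 = c\<^sub>0 c\<^sub>1 c\<^sub>2\<^sup>-\<^sup>1\<close> for \<open>c\<^sub>k = s\<^sup>k c s\<^sup>-\<^sup>k\<close>, so \<open>Q'\<close> is a
  quotient of three copies of \<open>\<int>/3\<close> times the free abelian group on the conjugates of \<open>d\<close>.  Two
  homomorphisms of \<open>VB\<^sub>n\<close> to a semidirect product with functions on \<open>\<int>\<close>, one killing \<open>d\<close> and
  sending \<open>c\<close> to a solution of the recurrence mod 3, the other killing \<open>c\<close>, show that there are
  no further relations.  For \<open>n \<ge> 4\<close> the element \<open>\<rho>\<^sub>1\<rho>\<^sub>3\<close> of \<open>Q\<close> has order dividing 2 and 3, whence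
  \<open>\<rho>\<^sub>1 = \<rho>\<^sub>3\<close> and \<open>d = 1\<close>; for \<open>n \<ge> 5\<close> all \<open>\<rho>\<^sub>i\<close> coincide in the same way, and \<open>Q\<close> is abelian.\<close>

section \<open>Derived subgroups and commuting generators\<close>

lemma (in group) inv_mult_cancel_left:
  assumes "x \<in> carrier G" "y \<in> carrier G"
  shows "inv x \<otimes> (x \<otimes> y) = y" "x \<otimes> (inv x \<otimes> y) = y"
  using assms by (simp_all flip: m_assoc)

text \<open>Rewriting with these facts brackets products to the right and cancels adjacent inverses,
  so \<open>simp\<close> decides equations between words by free reduction.\<close>

lemmas (in group) group_word_simps = m_assoc inv_mult_group inv_mult_cancel_left

lemma (in group) commutator_eq_one_iff:
  assumes "x \<in> carrier G" "y \<in> carrier G"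
  shows "x \<otimes> y \<otimes> inv x \<otimes> inv y = \<one> \<longleftrightarrow> x \<otimes> y = y \<otimes> x"
proof -
  have "x \<otimes> y \<otimes> inv x \<otimes> inv y = (x \<otimes> y) \<otimes> inv (y \<otimes> x)"
    using assms by (simp add: inv_mult_group m_assoc)
  then show ?thesis
    using assms by (metis inv_closed inv_equality inv_inv m_closed r_inv)
qed

lemma (in group) commutator_in_derived:
  "x \<in> H \<Longrightarrow> y \<in> H \<Longrightarrow> x \<otimes> y \<otimes> inv x \<otimes> inv y \<in> derived G H"
  unfolding derived_def by (rule generate.incl) blast

text \<open>The centralizer of \<open>y\<close> is a subgroup, so it contains everything generated
  by its elements.\<close>

lemma (in group) commute_generate:
  assumes "S \<subseteq> carrier G" "y \<in> carrier G" "\<And>s. s \<in> S \<Longrightarrow> s \<otimes> y = y \<otimes> s"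
    and "x \<in> generate G S"
  shows "x \<otimes> y = y \<otimes> x"
  using assms(4)
proof (induction rule: generate.induct)
  case one
  then show ?case using assms(2) by simp
next
  case (incl h)
  then show ?case using assms(3) by simp
next
  case (inv h)
  then have h: "h \<in> carrier G" "h \<otimes> y = y \<otimes> h" using assms(1,3) by auto
  then have "inv h \<otimes> (h \<otimes> y) \<otimes> inv h = inv h \<otimes> (y \<otimes> h) \<otimes> inv h" by simp
  then show ?case using h(1) assms(2) by (simp add: group_word_simps)
next
  case (eng h1 h2)
  then have h: "h1 \<in> carrier G" "h2 \<in> carrier G"
    using generate_in_carrier[OF assms(1)] by auto
  have "h1 \<otimes> h2 \<otimes> y = h1 \<otimes> (y \<otimes> h2)"
    using eng.IH(2) h assms(2) by (simp add: m_assoc)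
  also have "\<dots> = (y \<otimes> h1) \<otimes> h2"
    using eng.IH(1) h assms(2) by (simp flip: m_assoc)
  also have "\<dots> = y \<otimes> (h1 \<otimes> h2)"
    using h assms(2) by (simp add: m_assoc)
  finally show ?case .
qed

lemma (in group) comm_group_if_generators_commute:
  assumes "S \<subseteq> carrier G" "generate G S = carrier G"
    and "\<And>x y. x \<in> S \<Longrightarrow> y \<in> S \<Longrightarrow> x \<otimes> y = y \<otimes> x"
  shows "comm_group G"
proof (rule group_comm_groupI)
  fix x y assume "x \<in> carrier G" "y \<in> carrier G"
  moreover have "s \<otimes> y = y \<otimes> s" if "s \<in> S" "y \<in> carrier G" for s y
    using commute_generate[OF assms(1), of s y] assms that by (metis subsetD)
  ultimately show "x \<otimes> y = y \<otimes> x"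
    using commute_generate[OF assms(1), of y x] assms(2) by auto
qed

text \<open>The images of the generators commute in \<open>G Mod N\<close>, so that quotient is
  abelian and \<open>N\<close> absorbs every commutator.\<close>

lemma (in group) derived_subset_if_generators_commute:
  assumes "S \<subseteq> carrier G" "generate G S = carrier G" "N \<lhd> G"
    and "\<And>x y. x \<in> S \<Longrightarrow> y \<in> S \<Longrightarrow> x \<otimes> y \<otimes> inv x \<otimes> inv y \<in> N"
  shows "derived G (carrier G) \<subseteq> N"
proof (rule derived_minimal[OF assms(3)])
  interpret N: normal N G by fact
  interpret F: group "G Mod N" by (rule N.factorgroup_is_group)
  interpret h: group_hom G "G Mod N" "(#>) N"
    by unfold_locales (rule N.r_coset_hom_Mod)
  have "generate (G Mod N) ((#>) N ` S) = carrier (G Mod N)"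
    using h.generate_img[OF assms(1)] assms(2) by (simp add: carrier_FactGroup)
  moreover have "(N #> x) \<otimes>\<^bsub>G Mod N\<^esub> (N #> y) = (N #> y) \<otimes>\<^bsub>G Mod N\<^esub> (N #> x)"
    if "x \<in> S" "y \<in> S" for x y
  proof -
    have xy: "x \<in> carrier G" "y \<in> carrier G" using that assms(1) by auto
    have "N #> (x \<otimes> y \<otimes> inv x \<otimes> inv y) = N"
      using assms(4)[OF that] N.rcos_const by simp
    then have "(N #> x) \<otimes>\<^bsub>G Mod N\<^esub> (N #> y) \<otimes>\<^bsub>G Mod N\<^esub> inv\<^bsub>G Mod N\<^esub> (N #> x)
        \<otimes>\<^bsub>G Mod N\<^esub> inv\<^bsub>G Mod N\<^esub> (N #> y) = \<one>\<^bsub>G Mod N\<^esub>"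
      using xy by (simp del: h.hom_mult h.hom_inv mult_FactGroup add: h.hom_mult[symmetric] h.hom_inv[symmetric])
    then show ?thesis
      using F.commutator_eq_one_iff h.hom_closed xy by metis
  qed
  ultimately show "comm_group (G Mod N)"
    using assms(1) h.hom_closed
    by (intro F.comm_group_if_generators_commute[of "(#>) N ` S"]) (auto simp del: mult_FactGroup)
qed

section \<open>Normality of subgroups given by generators\<close>

lemma (in group) conj_generate_closed:
  assumes "S \<subseteq> carrier G" "g \<in> carrier G" "\<And>x. x \<in> S \<Longrightarrow> g \<otimes> x \<otimes> inv g \<in> generate G S"
    and "x \<in> generate G S"
  shows "g \<otimes> x \<otimes> inv g \<in> generate G S"
  using assms(4)
proof (induction rule: generate.induct)
  case one
  then show ?case using assms(2) generate.one by simp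
next
  case (incl h)
  then show ?case using assms(3) by simp
next
  case (inv h)
  then have "g \<otimes> inv h \<otimes> inv g = inv (g \<otimes> h \<otimes> inv g)"
    using assms(1,2) by (auto simp: inv_mult_group m_assoc)
  then show ?case using generate_m_inv_closed[OF assms(1) assms(3)[OF inv]] by simp
next
  case (eng h1 h2)
  then have h: "h1 \<in> carrier G" "h2 \<in> carrier G"
    using generate_in_carrier[OF assms(1)] by auto
  have "g \<otimes> (h1 \<otimes> h2) \<otimes> inv g = (g \<otimes> h1 \<otimes> inv g) \<otimes> (g \<otimes> h2 \<otimes> inv g)"
    using h assms(2) by (simp add: group_word_simps)
  then show ?case using generate.eng[OF eng.IH] by simp
qed

text \<open>The elements that conjugate the subgroup into itself are closed under products but not
  obviously under inverses, hence one hypothesis for \<open>t\<close> and one for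
  \<open>inv t\<close>.\<close>

lemma (in group) normal_generate_if_conj_generators:
  assumes "S \<subseteq> carrier G" "T \<subseteq> carrier G" "generate G T = carrier G"
    and "\<And>t x. t \<in> T \<Longrightarrow> x \<in> S \<Longrightarrow> t \<otimes> x \<otimes> inv t \<in> generate G S"
    and "\<And>t x. t \<in> T \<Longrightarrow> x \<in> S \<Longrightarrow> inv t \<otimes> x \<otimes> t \<in> generate G S"
  shows "generate G S \<lhd> G"
proof (rule normal_invI[OF generate_is_subgroup[OF assms(1)]])
  fix g h assume "g \<in> carrier G" "h \<in> generate G S"
  then have "g \<in> generate G T" using assms(3) by simp
  then show "g \<otimes> h \<otimes> inv g \<in> generate G S"
    using \<open>h \<in> generate G S\<close>
  proof (induction arbitrary: h rule: generate.induct)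
    case one
    then show ?case using generate_in_carrier[OF assms(1)] by simp
  next
    case (incl t)
    then have "t \<in> carrier G" using assms(2) by blast
    then show ?case using conj_generate_closed[OF assms(1) _ assms(4)[OF incl(1)] incl(2)] by blast
  next
    case (inv t)
    then have "t \<in> carrier G" using assms(2) by blast
    then show ?case
      using conj_generate_closed[OF assms(1), of "inv t" h] assms(5)[OF inv(1)] inv(2) by simp
  next
    case (eng g1 g2)
    have g: "g1 \<in> carrier G" "g2 \<in> carrier G" "h \<in> carrier G"
      using eng assms generate_in_carrier by auto
    have "g1 \<otimes> g2 \<otimes> h \<otimes> inv (g1 \<otimes> g2) = g1 \<otimes> (g2 \<otimes> h \<otimes> inv g2) \<otimes> inv g1"
      using g by (simp add: inv_mult_group m_assoc)
    then show ?case using eng by simp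
  qed
qed

text \<open>A conjugate of a commutator is the commutator of the conjugates, and these stay in
  \<open>N\<close>.\<close>

lemma (in group) normal_derived:
  assumes "N \<lhd> G" shows "derived G N \<lhd> G"
proof -
  interpret N: normal N G by fact
  show ?thesis unfolding derived_def
  proof (rule normal_generateI)
    show "derived_set G N \<subseteq> carrier G"
      using derived_set_in_carrier[OF N.subset] .
    fix h g assume "h \<in> derived_set G N" and g: "g \<in> carrier G"
    then obtain a b where ab: "a \<in> N" "b \<in> N" "h = a \<otimes> b \<otimes> inv a \<otimes> inv b" by auto
    let ?c = "\<lambda>x. g \<otimes> x \<otimes> inv g"
    have [simp]: "a \<in> carrier G" "b \<in> carrier G" using ab N.subset by auto
    have "?c h = ?c a \<otimes> ?c b \<otimes> inv (?c a) \<otimes> inv (?c b)"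
      using g ab by (simp add: group_word_simps)
    moreover have "?c a \<in> N" "?c b \<in> N" using ab g N.inv_op_closed2 by auto
    ultimately show "?c h \<in> derived_set G N" by blast
  qed
qed

lemma Mod_restrict_eq:
  fixes G (structure)
  shows "G\<lparr>carrier := H\<rparr> Mod N = (G Mod N)\<lparr>carrier := (#>) N ` H\<rparr>"
  unfolding FactGroup_def RCOSETS_def r_coset_def set_mult_def by auto

text \<open>Passing to the quotient by the second derived subgroup turns \<open>G' / G''\<close> into a derived
  subgroup, so that all computations can be done with equations in a metabelian group.\<close>

lemma (in group) derived_Mod_eq_derived_metabelian:
  fixes D K defines "D \<equiv> derived G (carrier G)" and "K \<equiv> derived G D"
  shows "K \<lhd> G"
    and "G\<lparr>carrier := D\<rparr> Mod K = (G Mod K)\<lparr>carrier := derived (G Mod K) (carrier (G Mod K))\<rparr>"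
    and "\<And>x y. x \<in> derived (G Mod K) (carrier (G Mod K)) \<Longrightarrow>
      y \<in> derived (G Mod K) (carrier (G Mod K)) \<Longrightarrow> x \<otimes>\<^bsub>G Mod K\<^esub> y = y \<otimes>\<^bsub>G Mod K\<^esub> x"
proof -
  have D: "D \<lhd> G" unfolding D_def by (rule derived_self_is_normal)
  interpret D: normal D G by fact
  show K: "K \<lhd> G" unfolding K_def by (rule normal_derived[OF D])
  interpret K: normal K G by fact
  interpret F: group "G Mod K" by (rule K.factorgroup_is_group)
  interpret h: group_hom G "G Mod K" "(#>) K"
    by unfold_locales (rule K.r_coset_hom_Mod)
  have D': "derived (G Mod K) (carrier (G Mod K)) = (#>) K ` D"
    using h.derived_img[of "carrier G"] by (simp add: carrier_FactGroup D_def)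
  show "G\<lparr>carrier := D\<rparr> Mod K = (G Mod K)\<lparr>carrier := derived (G Mod K) (carrier (G Mod K))\<rparr>"
    unfolding Mod_restrict_eq D' ..
  fix x y assume "x \<in> derived (G Mod K) (carrier (G Mod K))" "y \<in> derived (G Mod K) (carrier (G Mod K))"
  then obtain a b where ab: "x = K #> a" "y = K #> b" "a \<in> D" "b \<in> D" using D' by auto
  have c: "a \<in> carrier G" "b \<in> carrier G" using ab D.subset by auto
  have "a \<otimes> b \<otimes> inv a \<otimes> inv b \<in> K"
    unfolding K_def using ab by (intro commutator_in_derived)
  then have "K #> (a \<otimes> b \<otimes> inv a \<otimes> inv b) = K" using K.rcos_const by simp
  then have "x \<otimes>\<^bsub>G Mod K\<^esub> y \<otimes>\<^bsub>G Mod K\<^esub> inv\<^bsub>G Mod K\<^esub> x \<otimes>\<^bsub>G Mod K\<^esub> inv\<^bsub>G Mod K\<^esub> y = \<one>\<^bsub>G Mod K\<^esub>"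
    using ab c by (simp del: h.hom_mult h.hom_inv mult_FactGroup add: h.hom_mult[symmetric] h.hom_inv[symmetric])
  then show "x \<otimes>\<^bsub>G Mod K\<^esub> y = y \<otimes>\<^bsub>G Mod K\<^esub> x"
    using F.commutator_eq_one_iff h.hom_closed c ab by metis
qed

section \<open>Homomorphisms out of cyclic groups and direct products\<close>

lemma (in group) hom_int_pow_mod:
  assumes "x \<in> carrier G" "x [^] n = \<one>" "n > 0"
  shows "(\<lambda>i::int. x [^] i) \<in> hom (integer_mod_group n) G"
proof (rule homI)
  fix i j :: int
  assume "i \<in> carrier (integer_mod_group n)" "j \<in> carrier (integer_mod_group n)"
  \<comment> \<open>Products in \<open>integer_mod_group n\<close> are reduced modulo
    \<open>n\<close>; the power of \<open>x\<close> does not notice the discarded multiple of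
    \<open>n\<close>.\<close>
  have "x [^] (int n * k) = \<one>" for k :: int
    using assms(1,2) by (simp add: int_pow_int flip: int_pow_pow)
  then have "x [^] ((i + j) mod int n + int n * ((i + j) div int n)) = x [^] ((i + j) mod int n)"
    using assms(1) by (simp only: int_pow_mult) simp
  then show "x [^] (i \<otimes>\<^bsub>integer_mod_group n\<^esub> j) = x [^] i \<otimes> x [^] j"
    using assms(1) by (simp add: int_pow_mult)
qed (use assms in simp)

lemma (in comm_group) hom_DirProd_mult:
  assumes "f \<in> hom A G" "g \<in> hom B G"
  shows "(\<lambda>(a, b). f a \<otimes> g b) \<in> hom (A \<times>\<times> B) G"
  using assms unfolding hom_def by (auto simp: Pi_iff m_ac)

section \<open>Homomorphisms out of presented groups\<close>

definition eval_word :: "('b, 'm) monoid_scheme \<Rightarrow> ('g \<Rightarrow> 'b) \<Rightarrow> 'g word \<Rightarrow> 'b" where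
  "eval_word H f w = foldr (\<lambda>(x, e) a. (if e then f x else inv\<^bsub>H\<^esub> f x) \<otimes>\<^bsub>H\<^esub> a) w \<one>\<^bsub>H\<^esub>"

lemma eval_word_simps [simp]:
  "eval_word H f [] = \<one>\<^bsub>H\<^esub>"
  "eval_word H f ((x, e) # w) = (if e then f x else inv\<^bsub>H\<^esub> f x) \<otimes>\<^bsub>H\<^esub> eval_word H f w"
  by (simp_all add: eval_word_def)

context group
begin

lemma eval_word_closed:
  assumes "f \<in> S \<rightarrow> carrier G" "w \<in> words S"
  shows "eval_word G f w \<in> carrier G"
  using assms(2)
proof (induction w)
  case (Cons p w)
  then show ?case using assms(1) by (cases p) (auto simp: Pi_iff)
qed simp

lemma eval_word_append:
  assumes "f \<in> S \<rightarrow> carrier G" "v \<in> words S" "w \<in> words S"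
  shows "eval_word G f (v @ w) = eval_word G f v \<otimes> eval_word G f w"
  using assms(2)
proof (induction v)
  case Nil
  then show ?case using assms by (simp add: eval_word_closed)
next
  case (Cons p v)
  then show ?case using assms eval_word_closed[OF assms(1)]
    by (cases p) (auto simp: Pi_iff m_assoc)
qed

lemma eval_word_pres_rel:
  assumes f: "f \<in> S \<rightarrow> carrier G"
    and R: "\<And>l r. (l, r) \<in> R \<Longrightarrow> eval_word G f l = eval_word G f r"
    and "(v, w) \<in> pres_rel S R"
  shows "eval_word G f v = eval_word G f w"
  using assms(3)
proof (induction rule: pres_rel.induct)
  case (cancel u v x e)
  have "f x \<in> carrier G" using f cancel by auto
  then have "eval_word G f ([(x, e), (x, \<not> e)] @ v) = eval_word G f v"
    using eval_word_closed[OF f cancel(2)] by (simp add: inv_mult_cancel_left)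
  then show ?case
    using cancel eval_word_append[OF f, of u "[(x, e), (x, \<not> e)] @ v"] eval_word_append[OF f, of u v]
    by simp
next
  case (rel l r u v)
  then show ?case using R[of l r] by (simp add: eval_word_append[OF f])
qed auto

text \<open>This is von Dyck's theorem. Evaluation of words is constant on the classes of
  \<open>pres_rel S R\<close>, so any representative may be used to define the map.\<close>

lemma presented_group_hom:
  assumes f: "f \<in> S \<rightarrow> carrier G"
    and R: "\<And>l r. (l, r) \<in> R \<Longrightarrow> eval_word G f l = eval_word G f r"
  obtains h where "h \<in> hom (presented_group S R) G"
    and "\<And>w. w \<in> words S \<Longrightarrow> h (pres_rel S R `` {w}) = eval_word G f w"
proof
  let ?h = "\<lambda>A. eval_word G f (SOME w. w \<in> A)"
  show h: "?h (pres_rel S R `` {w}) = eval_word G f w" if "w \<in> words S" for w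
  proof -
    have "w \<in> pres_rel S R `` {w}" using that by (simp add: pres_rel.refl)
    then have "(SOME v. v \<in> pres_rel S R `` {w}) \<in> pres_rel S R `` {w}" by (rule someI)
    then show ?thesis using eval_word_pres_rel[OF f R] by auto
  qed
  show "?h \<in> hom (presented_group S R) G"
  proof (rule homI)
    have carr: "carrier (presented_group S R) = words S // pres_rel S R"
      by (simp add: presented_group_def)
    fix x assume "x \<in> carrier (presented_group S R)"
    then obtain a where a: "a \<in> words S" "x = pres_rel S R `` {a}"
      unfolding carr by (auto elim: quotientE)
    then show "?h x \<in> carrier G" using h f by (simp add: eval_word_closed)
    fix y assume "y \<in> carrier (presented_group S R)"
    then obtain b where b: "b \<in> words S" "y = pres_rel S R `` {b}"
      unfolding carr by (auto elim: quotientE)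
    show "?h (x \<otimes>\<^bsub>presented_group S R\<^esub> y) = ?h x \<otimes> ?h y"
      using a b h by (simp add: presented_group_mult_class eval_word_append[OF f])
  qed
qed

end

lemma generate_presented_group:
  "generate (presented_group S R) ((\<lambda>x. pres_rel S R `` {[(x, True)]}) ` S)
    = carrier (presented_group S R)" (is "generate ?P ?T = _")
proof
  interpret P: group ?P by (rule group_presented_group)
  have carr: "carrier ?P = words S // pres_rel S R"
    by (simp add: presented_group_def)
  have T: "?T \<subseteq> carrier ?P" unfolding carr by (auto intro: quotientI)
  then show "generate ?P ?T \<subseteq> carrier ?P" by (rule P.generate_incl)
  have "pres_rel S R `` {w} \<in> generate ?P ?T" if "w \<in> words S" for w
    using that
  proof (induction w)
    case Nil
    then show ?case using generate.one[of ?P ?T] by (simp add: presented_group_def)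
  next
    case (Cons p w)
    obtain x e where p: "p = (x, e)" by fastforce
    then have x: "x \<in> S" "w \<in> words S" using Cons by auto
    have one: "\<one>\<^bsub>?P\<^esub> = pres_rel S R `` {[]}" by (simp add: presented_group_def)
    have "pres_rel S R `` {[(x, False)]} \<otimes>\<^bsub>?P\<^esub> pres_rel S R `` {[(x, True)]} = \<one>\<^bsub>?P\<^esub>"
      using x pres_rel.cancel[of "[]" S "[]" x False R]
      by (simp add: presented_group_mult_class one equiv_class_eq[OF equiv_pres_rel])
    \<comment> \<open>The class of a formal inverse letter is the group inverse, so negative letters
      also lie in the generated subgroup.\<close>
    then have inv: "inv\<^bsub>?P\<^esub> (pres_rel S R `` {[(x, True)]}) = pres_rel S R `` {[(x, False)]}"
      using x by (intro P.inv_equality) (auto simp: carr intro: quotientI)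
    have "pres_rel S R `` {[p]} \<in> generate ?P ?T"
    proof (cases e)
      case True
      then show ?thesis using p x by (auto intro: generate.incl)
    next
      case False
      then show ?thesis using p x inv generate.inv[of "pres_rel S R `` {[(x, True)]}" ?T ?P] by simp
    qed
    then have "pres_rel S R `` {[p]} \<otimes>\<^bsub>?P\<^esub> pres_rel S R `` {w} \<in> generate ?P ?T"
      using Cons.IH[OF x(2)] by (rule generate.eng)
    then show ?case using x p by (simp add: presented_group_mult_class)
  qed
  then show "carrier ?P \<subseteq> generate ?P ?T" unfolding carr by (auto elim!: quotientE)
qed

section \<open>Families satisfying the virtual braid relations\<close>

text \<open>Products are bracketed to the right because this is the shape that
  \<open>eval_word\<close> unfolds to.\<close>

locale vb_relations = group G for G (structure) +
  fixes n :: nat and \<sigma> \<rho> :: "nat \<Rightarrow> 'a"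
  assumes sigma_closed: "i \<in> {1..n-1} \<Longrightarrow> \<sigma> i \<in> carrier G"
    and rho_closed: "i \<in> {1..n-1} \<Longrightarrow> \<rho> i \<in> carrier G"
    and sigma_far: "i \<in> {1..n-1} \<Longrightarrow> j \<in> {1..n-1} \<Longrightarrow> far i j \<Longrightarrow> \<sigma> i \<otimes> \<sigma> j = \<sigma> j \<otimes> \<sigma> i"
    and sigma_braid: "i \<in> {1..n-2} \<Longrightarrow>
      \<sigma> i \<otimes> (\<sigma> (i+1) \<otimes> \<sigma> i) = \<sigma> (i+1) \<otimes> (\<sigma> i \<otimes> \<sigma> (i+1))"
    and rho_square: "i \<in> {1..n-1} \<Longrightarrow> \<rho> i \<otimes> \<rho> i = \<one>"
    and rho_far: "i \<in> {1..n-1} \<Longrightarrow> j \<in> {1..n-1} \<Longrightarrow> far i j \<Longrightarrow> \<rho> i \<otimes> \<rho> j = \<rho> j \<otimes> \<rho> i"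
    and rho_braid: "i \<in> {1..n-2} \<Longrightarrow>
      \<rho> i \<otimes> (\<rho> (i+1) \<otimes> \<rho> i) = \<rho> (i+1) \<otimes> (\<rho> i \<otimes> \<rho> (i+1))"
    and mixed_far: "i \<in> {1..n-1} \<Longrightarrow> j \<in> {1..n-1} \<Longrightarrow> far i j \<Longrightarrow> \<sigma> i \<otimes> \<rho> j = \<rho> j \<otimes> \<sigma> i"
    and mixed_braid: "i \<in> {1..n-2} \<Longrightarrow>
      \<rho> i \<otimes> (\<rho> (i+1) \<otimes> \<sigma> i) = \<sigma> (i+1) \<otimes> (\<rho> i \<otimes> \<rho> (i+1))"

locale vb_generators = vb_relations +
  assumes generators: "generate G (\<sigma> ` {1..n-1} \<union> \<rho> ` {1..n-1}) = carrier G"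

definition VB_class :: "nat \<Rightarrow> vb_gen word \<Rightarrow> vb_gen word set" where
  "VB_class n w = pres_rel (VB_gens n) (VB_rels n) `` {w}"

lemma VB_class_mult:
  assumes "v \<in> words (VB_gens n)" "w \<in> words (VB_gens n)"
  shows "VB_class n v \<otimes>\<^bsub>VB n\<^esub> VB_class n w = VB_class n (v @ w)"
  using assms by (simp add: VB_class_def VB_def presented_group_mult_class)

lemma VB_class_closed: "w \<in> words (VB_gens n) \<Longrightarrow> VB_class n w \<in> carrier (VB n)"
  by (auto simp: VB_class_def VB_def presented_group_def intro: quotientI)

lemma VB_class_eqI:
  assumes "(l, r) \<in> VB_rels n" "l \<in> words (VB_gens n)" "r \<in> words (VB_gens n)"
  shows "VB_class n l = VB_class n r"
  using pres_rel.rel[OF assms(1), of "[]" "VB_gens n" "[]"] assms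
  by (simp add: VB_class_def equiv_class_eq[OF equiv_pres_rel])

lemma in_VB_gens [simp]:
  "Sigma i \<in> VB_gens n \<longleftrightarrow> i \<in> {1..n-1}"
  "Rho i \<in> VB_gens n \<longleftrightarrow> i \<in> {1..n-1}"
  by (auto simp: VB_gens_def)

lemma vb_generators_VB:
  "vb_generators (VB n) n (\<lambda>i. VB_class n [sg i]) (\<lambda>i. VB_class n [rh i])"
proof -
  interpret group "VB n" by (rule group_VB)
  have one: "\<one>\<^bsub>VB n\<^esub> = VB_class n []" by (simp add: VB_class_def VB_def presented_group_def)
  have "(\<lambda>i. VB_class n [sg i]) ` {1..n-1} \<union> (\<lambda>i. VB_class n [rh i]) ` {1..n-1}
      = (\<lambda>x. VB_class n [(x, True)]) ` VB_gens n"
    by (auto simp: VB_gens_def)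
  then have "generate (VB n) ((\<lambda>i. VB_class n [sg i]) ` {1..n-1} \<union> (\<lambda>i. VB_class n [rh i]) ` {1..n-1})
      = carrier (VB n)"
    using generate_presented_group[of "VB_gens n" "VB_rels n"] by (simp add: VB_def VB_class_def)
  moreover have "i \<in> {1..n-1}" "i + 1 \<in> {1..n-1}" if "i \<in> {1..n-2}" for i using that by auto
  ultimately show ?thesis
    by (unfold_locales, simp_all add: VB_class_closed VB_class_mult one
        del: atLeastAtMost_iff One_nat_def Suc_eq_plus1)
      (rule VB_class_eqI; auto intro: VB_rels.intros simp del: atLeastAtMost_iff One_nat_def)+
qed

lemma (in vb_relations) VB_hom:
  obtains h where "h \<in> hom (VB n) G"
    and "\<And>i. i \<in> {1..n-1} \<Longrightarrow> h (VB_class n [sg i]) = \<sigma> i"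
    and "\<And>i. i \<in> {1..n-1} \<Longrightarrow> h (VB_class n [rh i]) = \<rho> i"
proof -
  define f where "f x = (case x of Sigma i \<Rightarrow> \<sigma> i | Rho i \<Rightarrow> \<rho> i)" for x
  have [simp]: "f (Sigma i) = \<sigma> i" "f (Rho i) = \<rho> i" for i by (simp_all add: f_def)
  have f: "f \<in> VB_gens n \<rightarrow> carrier G"
    using sigma_closed rho_closed by (auto simp: VB_gens_def)
  have sub: "i \<in> {1..n-1}" "i + 1 \<in> {1..n-1}" if "i \<in> {1..n-2}" for i using that by auto
  have "eval_word G f l = eval_word G f r" if "(l, r) \<in> VB_rels n" for l r
    using that
    by cases (use sub in \<open>auto simp: sigma_closed rho_closed sigma_braid rho_square
      rho_braid mixed_far mixed_braid simp del: atLeastAtMost_iff One_nat_def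
      intro: sigma_far rho_far\<close>)
  then obtain h where h: "h \<in> hom (presented_group (VB_gens n) (VB_rels n)) G"
    "\<And>w. w \<in> words (VB_gens n) \<Longrightarrow> h (VB_class n w) = eval_word G f w"
    using presented_group_hom[OF f] unfolding VB_class_def by blast
  show thesis
    by (rule that[of h])
      (use h sigma_closed rho_closed in \<open>auto simp: VB_def simp del: atLeastAtMost_iff One_nat_def\<close>)
qed

lemma (in vb_generators) vb_generators_Mod:
  assumes "N \<lhd> G"
  shows "vb_generators (G Mod N) n (\<lambda>i. N #> \<sigma> i) (\<lambda>i. N #> \<rho> i)"
proof -
  interpret N: normal N G by fact
  interpret F: group "G Mod N" by (rule N.factorgroup_is_group)
  interpret h: group_hom G "G Mod N" "(#>) N"
    by unfold_locales (rule N.r_coset_hom_Mod)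
  have S: "\<sigma> ` {1..n-1} \<union> \<rho> ` {1..n-1} \<subseteq> carrier G" using sigma_closed rho_closed by auto
  have gen: "generate (G Mod N) ((\<lambda>i. N #> \<sigma> i) ` {1..n-1} \<union> (\<lambda>i. N #> \<rho> i) ` {1..n-1})
      = carrier (G Mod N)"
    using h.generate_img[OF S] generators by (simp add: carrier_FactGroup image_Un image_image)
  have sub: "i \<in> {1..n-1}" "i + 1 \<in> {1..n-1}" if "i \<in> {1..n-2}" for i using that by auto
  have far: "N #> \<sigma> i \<otimes> \<sigma> j = N #> \<sigma> j \<otimes> \<sigma> i" "N #> \<rho> i \<otimes> \<rho> j = N #> \<rho> j \<otimes> \<rho> i"
    if "i \<in> {1..n-1}" "j \<in> {1..n-1}" "far i j" for i j
    using sigma_far[OF that] rho_far[OF that] by simp_all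
  note [simp del] = atLeastAtMost_iff One_nat_def mult_FactGroup one_FactGroup h.hom_mult
  show ?thesis
    by (unfold_locales, use sub in \<open>simp_all add: gen sigma_closed rho_closed sigma_braid rho_square
        rho_braid mixed_far mixed_braid h.hom_mult[symmetric]\<close>) (rule far; assumption)+
qed

section \<open>The signed shift group\<close>

text \<open>The semidirect product of the functions on the integers with the group generated by the
  shift \<open>u \<mapsto> u(\<cdot> + 1)\<close> and the sign change: the Magnus-type target that detects \<open>G' / G''\<close>.
  The last component is \<open>True\<close> for the sign change.\<close>

definition signed_shift :: "((int \<Rightarrow> 'a::ab_group_add) \<times> int \<times> bool) monoid" where
  "signed_shift = \<lparr>carrier = UNIV,
     monoid.mult = (\<lambda>(v, k, e) (w, l, f).
       (\<lambda>j. v j + (if e then - w (j + k) else w (j + k)), k + l, e \<noteq> f)),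
     one = (\<lambda>_. 0, 0, False)\<rparr>"

lemma signed_shift_simps [simp]:
  "carrier signed_shift = UNIV"
  "(v, k, e) \<otimes>\<^bsub>signed_shift\<^esub> (w, l, f) =
    (\<lambda>j. v j + (if e then - w (j + k) else w (j + k)), k + l, e \<noteq> f)"
  "\<one>\<^bsub>signed_shift\<^esub> = (\<lambda>_. 0, 0, False)"
  by (simp_all add: signed_shift_def)

lemma group_signed_shift: "group signed_shift"
proof (rule groupI)
  fix x y z :: "(int \<Rightarrow> 'a) \<times> int \<times> bool"
  obtain v k e w l f u m g where "x = (v, k, e)" "y = (w, l, f)" "z = (u, m, g)"
    by (metis prod.exhaust)
  then show "x \<otimes>\<^bsub>signed_shift\<^esub> y \<otimes>\<^bsub>signed_shift\<^esub> z = x \<otimes>\<^bsub>signed_shift\<^esub> (y \<otimes>\<^bsub>signed_shift\<^esub> z)"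
    by (auto simp: fun_eq_iff algebra_simps)
  show "\<one>\<^bsub>signed_shift\<^esub> \<otimes>\<^bsub>signed_shift\<^esub> x = x"
    using \<open>x = _\<close> by auto
  have "(\<lambda>j. if e then v (j - k) else - v (j - k), - k, e) \<otimes>\<^bsub>signed_shift\<^esub> x = \<one>\<^bsub>signed_shift\<^esub>"
    using \<open>x = _\<close> by auto
  then show "\<exists>y\<in>carrier signed_shift. y \<otimes>\<^bsub>signed_shift\<^esub> x = \<one>\<^bsub>signed_shift\<^esub>" by auto
qed auto

lemma inv_signed_shift [simp]:
  "inv\<^bsub>signed_shift\<^esub> (v, k, e) = (\<lambda>j. if e then v (j - k) else - v (j - k), - k, e)"
  by (rule group.inv_equality[OF group_signed_shift]) auto

text \<open>The last two components multiply as in the abelian group \<int> x \<int>/2, so both are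
  trivial on commutators.\<close>

lemma derived_signed_shift: "derived signed_shift UNIV \<subseteq> {(u, k, e). k = 0 \<and> \<not> e}"
  unfolding derived_def
proof (rule group.generate_subgroup_incl[OF group_signed_shift])
  show "subgroup {(u, k, e). k = 0 \<and> \<not> e} signed_shift"
    by (rule group.subgroupI[OF group_signed_shift]) auto
qed auto

text \<open>Elements with trivial last two components multiply by pointwise addition of functions
  and therefore commute: the group is metabelian.\<close>

lemma derived_derived_signed_shift: "derived signed_shift (derived signed_shift UNIV) = {\<one>\<^bsub>signed_shift\<^esub>}"
proof
  have "generate signed_shift (derived_set signed_shift (derived signed_shift UNIV))
      \<subseteq> {\<one>\<^bsub>signed_shift :: ((int \<Rightarrow> 'a) \<times> int \<times> bool) monoid\<^esub>}"
  proof (rule group.generate_subgroup_incl[OF group_signed_shift])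
    show "subgroup {\<one>\<^bsub>signed_shift\<^esub>} signed_shift"
      by (rule group.triv_subgroup[OF group_signed_shift])
    have "a \<otimes>\<^bsub>signed_shift\<^esub> b \<otimes>\<^bsub>signed_shift\<^esub> inv\<^bsub>signed_shift\<^esub> a \<otimes>\<^bsub>signed_shift\<^esub> inv\<^bsub>signed_shift\<^esub> b
        = \<one>\<^bsub>signed_shift\<^esub>"
      if ab: "a \<in> derived signed_shift UNIV" "b \<in> derived signed_shift UNIV"
      for a b :: "(int \<Rightarrow> 'a) \<times> int \<times> bool"
    proof -
      obtain p q where "a = (p, 0, False)" "b = (q, 0, False)"
        using subsetD[OF derived_signed_shift ab(1)] subsetD[OF derived_signed_shift ab(2)] by auto
      then show ?thesis by simp
    qed
    then show "derived_set signed_shift (derived signed_shift UNIV)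
      \<subseteq> {\<one>\<^bsub>signed_shift :: ((int \<Rightarrow> 'a) \<times> int \<times> bool) monoid\<^esub>}"
      by blast
  qed
  then show "derived signed_shift (derived signed_shift UNIV) \<subseteq> {\<one>\<^bsub>signed_shift :: ((int \<Rightarrow> 'a) \<times> int \<times> bool) monoid\<^esub>}"
    unfolding derived_def .
qed (auto simp: derived_def simp del: signed_shift_simps intro: generate.one)

text \<open>The values are chosen so that \<rho>_1 \<rho>_2 goes to \<open>(u, 0, False)\<close>.
  The value at \<sigma>_2 is then forced, being the conjugate of the value
  \<open>(v, 1, False)\<close> at \<sigma>_1 by that element. The hypothesis \<open>three\<close>
  serves the braid relation of the \<rho>_i and, with \<open>rec\<close>, that of the \<sigma>_i; on
  four strands \<sigma>_1 must commute with \<rho>_3, which has the same image as \<rho>_1 and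
  changes the sign of \<open>v\<close>.\<close>

lemma vb_relations_signed_shift:
  fixes u v :: "int \<Rightarrow> 'a::ab_group_add"
  assumes "n \<le> 4" and v: "n = 4 \<Longrightarrow> v = (\<lambda>_. 0)"
    and three: "\<And>j. u j + u j + u j = 0"
    and rec: "\<And>j. u (j + 3) = u j + u (j + 1) - u (j + 2)"
  shows "vb_relations signed_shift n
    (\<lambda>i. if odd i then (v, 1, False) else (\<lambda>j. u j + v j - u (j + 1), 1, False))
    (\<lambda>i. if odd i then (\<lambda>_. 0, 0, True) else (\<lambda>j. - u j, 0, True))"
proof -
  interpret group "signed_shift :: ((int \<Rightarrow> 'a) \<times> int \<times> bool) monoid" by (rule group_signed_shift)
  \<comment> \<open>The only distant indices are 1 and 3 on four strands, and both are odd.\<close>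
  have far: "n = 4 \<and> odd i \<and> odd j" if "i \<in> {1..n-1}" "j \<in> {1..n-1}" "far i j" for i j
  proof -
    have "i \<in> {1,2,3}" "j \<in> {1,2,3}" using that assms(1) by auto
    then show ?thesis using that assms(1) by (auto simp: far_def)
  qed
  \<comment> \<open>This is the braid relation of \<sigma>_1 and \<sigma>_2 in the function
    component, after the terms in \<open>v\<close> have cancelled.\<close>
  have t: "u (j + 1) - u (j + 2) = u j - u (j + 1) + u (j + 2) - u (j + 3)" for j
  proof -
    have "u (j + 1) - u (j + 2) - (u j - u (j + 1) + u (j + 2) - u (j + 3))
        = (u (j + 1) + u (j + 1) + u (j + 1)) - (u (j + 2) + u (j + 2) + u (j + 2))"
      unfolding rec by (simp add: algebra_simps)
    then show ?thesis unfolding three by simp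
  qed
  have three': "u j + (u j + u j) = 0" "u j + (u j + (u j + b)) = b" for j b
    using three[of j] by (simp_all flip: add.assoc)
  have neg: "- u j = u j + u j" for j
    using three'(1)[of j] by (simp add: neg_eq_iff_add_eq_0)
  show ?thesis
    by unfold_locales
      (use far v t in \<open>auto simp: fun_eq_iff algebra_simps three' neg\<close>)
qed

section \<open>Metabelian groups generated like the metabelian quotient of the third group\<close>

text \<open>Solving for \<open>w\<close> gives x y^-2 z^2; since \<open>y\<close> and
  \<open>z\<close> have trivial cubes, y^-2 = y and z^2 = z^-1.\<close>

lemma (in comm_group) solve_braid_relation:
  assumes [simp]: "x \<in> carrier G" "y \<in> carrier G" "z \<in> carrier G" "w \<in> carrier G"
    and y3: "y \<otimes> (y \<otimes> y) = \<one>" and z3: "z \<otimes> (z \<otimes> z) = \<one>"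
    and eq: "y \<otimes> inv z = x \<otimes> inv y \<otimes> z \<otimes> inv w"
  shows "w = x \<otimes> y \<otimes> inv z"
proof -
  have iy: "inv y = y \<otimes> y" and iz: "inv z = z \<otimes> z"
    using y3 z3 by (simp_all add: inv_equality m_assoc)
  have "y \<otimes> (z \<otimes> z) \<otimes> w = x \<otimes> (y \<otimes> y) \<otimes> z"
    using arg_cong[OF eq, of "\<lambda>t. t \<otimes> w"] unfolding iy iz by (simp add: m_assoc)
  then have "(y \<otimes> y \<otimes> z) \<otimes> (y \<otimes> (z \<otimes> z) \<otimes> w) = (y \<otimes> y \<otimes> z) \<otimes> (x \<otimes> (y \<otimes> y) \<otimes> z)" by simp
  moreover have "(y \<otimes> y \<otimes> z) \<otimes> (y \<otimes> (z \<otimes> z) \<otimes> w) = (y \<otimes> (y \<otimes> y)) \<otimes> ((z \<otimes> (z \<otimes> z)) \<otimes> w)"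
    by (simp add: m_ac)
  moreover have "(y \<otimes> y \<otimes> z) \<otimes> (x \<otimes> (y \<otimes> y) \<otimes> z) = (y \<otimes> (y \<otimes> y)) \<otimes> (x \<otimes> y \<otimes> (z \<otimes> z))"
    by (simp add: m_ac)
  ultimately show ?thesis unfolding y3 z3 iz by simp
qed

lemma (in group) additive_int_pow:
  fixes w :: "'a \<Rightarrow> 'e::ring_1"
  assumes w: "\<And>x y. x \<in> carrier G \<Longrightarrow> y \<in> carrier G \<Longrightarrow> w (x \<otimes> y) = w x + w y"
    and x: "x \<in> carrier G"
  shows "w (x [^] (i::int)) = of_int i * w x"
proof -
  have one: "w \<one> = 0" using w[of \<one> \<one>] by simp
  have nat: "w (x [^] n) = of_nat n * w x" for n :: nat
    by (induction n) (use x w one in \<open>simp_all add: algebra_simps\<close>)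
  have inv: "w (inv y) = - w y" if "y \<in> carrier G" for y
    using w[of y "inv y"] that one by (simp add: add_eq_0_iff)
  show ?thesis
    using x nat by (cases i rule: int_cases2) (simp_all add: int_pow_int int_pow_neg inv)
qed

text \<open>The common form of the quotients for three and four strands. The conjugate of
  \<open>s\<close> by \<open>c\<close> stands for \<sigma>_2, so \<open>braid\<close> is the braid
  relation of \<sigma>_1 and \<sigma>_2.\<close>

locale metabelian_triple = group G for G (structure) +
  fixes s r c
  assumes closed [simp]: "s \<in> carrier G" "r \<in> carrier G" "c \<in> carrier G"
    and generators: "generate G {s, r, c} = carrier G"
    and metabelian: "x \<in> derived G (carrier G) \<Longrightarrow> y \<in> derived G (carrier G) \<Longrightarrow> x \<otimes> y = y \<otimes> x"
    and r_square: "r \<otimes> r = \<one>"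
    and c_cube: "c \<otimes> (c \<otimes> c) = \<one>"
    and r_c_r: "r \<otimes> (c \<otimes> r) = inv c"
    and braid: "s \<otimes> ((c \<otimes> s \<otimes> inv c) \<otimes> s) = (c \<otimes> s \<otimes> inv c) \<otimes> (s \<otimes> (c \<otimes> s \<otimes> inv c))"
begin

definition D where "D = derived G (carrier G)"

text \<open>\<open>D\<close> as a group of its own, so that the results on abelian groups apply to
  it.\<close>

definition H where "H = G\<lparr>carrier := D\<rparr>"

text \<open>The commutator of \<open>s\<close> and \<open>r\<close>, written with \<open>r\<close>
  in place of its inverse.\<close>

definition d where "d = s \<otimes> r \<otimes> inv s \<otimes> r"

definition cj :: "int \<Rightarrow> 'a \<Rightarrow> 'a" where "cj k x = s [^] k \<otimes> x \<otimes> inv (s [^] k)"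

lemma normal_D: "D \<lhd> G"
  unfolding D_def by (rule derived_self_is_normal)

lemma subgroup_D: "subgroup D G"
  using normal_D by (rule normal_imp_subgroup)

lemma D_carrier [simp]: "x \<in> D \<Longrightarrow> x \<in> carrier G"
  using subgroup.mem_carrier[OF subgroup_D] .

lemma D_comm: "x \<in> D \<Longrightarrow> y \<in> D \<Longrightarrow> x \<otimes> y = y \<otimes> x"
  unfolding D_def by (rule metabelian)

lemma D_mult [simp]: "x \<in> D \<Longrightarrow> y \<in> D \<Longrightarrow> x \<otimes> y \<in> D"
  and D_inv [simp]: "x \<in> D \<Longrightarrow> inv x \<in> D"
  using subgroup.m_closed[OF subgroup_D] subgroup.m_inv_closed[OF subgroup_D] by simp_all

lemma D_conj [simp]: "g \<in> carrier G \<Longrightarrow> x \<in> D \<Longrightarrow> g \<otimes> x \<otimes> inv g \<in> D"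
  using normal.inv_op_closed2[OF normal_D] .

lemma comm_group_H: "comm_group H"
  unfolding H_def using D_comm
  by (intro group.group_comm_groupI subgroup_imp_group subgroup_D) auto

lemma H_simps [simp]: "carrier H = D" "x \<otimes>\<^bsub>H\<^esub> y = x \<otimes> y" "\<one>\<^bsub>H\<^esub> = \<one>"
  by (simp_all add: H_def)

lemma H_inv [simp]: "x \<in> D \<Longrightarrow> inv\<^bsub>H\<^esub> x = inv x"
  unfolding H_def using m_inv_consistent[OF subgroup_D] by simp

lemma commutator_in_D: "x \<in> carrier G \<Longrightarrow> y \<in> carrier G \<Longrightarrow> x \<otimes> y \<otimes> inv x \<otimes> inv y \<in> D"
  unfolding D_def by (rule commutator_in_derived)

lemma inv_r: "inv r = r"
  using r_square by (simp add: inv_equality)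

lemma r_cancel: "x \<in> carrier G \<Longrightarrow> r \<otimes> (r \<otimes> x) = x"
  using inv_mult_cancel_left(2)[of r x] by (simp add: inv_r)

lemma inv_c: "inv c = c \<otimes> c"
  using c_cube by (simp add: inv_equality m_assoc)

text \<open>Since \<open>r\<close> inverts \<open>c\<close>, the commutator is c^-2, which is
  \<open>c\<close> because the cube of \<open>c\<close> is trivial. This places \<open>c\<close> in
  \<open>D\<close>.\<close>

lemma r_c_commutator: "r \<otimes> c \<otimes> inv r \<otimes> inv c = c"
proof -
  have "r \<otimes> c \<otimes> inv r \<otimes> inv c = inv c \<otimes> inv c" by (simp add: inv_r r_c_r m_assoc flip: r_c_r)
  also have "\<dots> = c \<otimes> (c \<otimes> (c \<otimes> c))" by (simp add: inv_c m_assoc)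
  finally show ?thesis by (simp add: c_cube)
qed

lemma c_in_D [simp]: "c \<in> D"
  using commutator_in_D[of r c] by (simp add: r_c_commutator)

lemma d_in_D [simp]: "d \<in> D"
  using commutator_in_D[of s r] by (simp add: inv_r d_def)

lemma cj_in_D [simp]: "x \<in> D \<Longrightarrow> cj k x \<in> D"
  by (simp add: cj_def)

lemma cj_mult: "x \<in> D \<Longrightarrow> y \<in> D \<Longrightarrow> cj k (x \<otimes> y) = cj k x \<otimes> cj k y"
  by (simp add: cj_def group_word_simps)

lemma cj_inv: "x \<in> D \<Longrightarrow> cj k (inv x) = inv (cj k x)"
  by (simp add: cj_def group_word_simps)

lemma cj_cj: "x \<in> D \<Longrightarrow> cj k (cj l x) = cj (k + l) x"
  by (simp add: cj_def group_word_simps int_pow_mult)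

lemma cj_0 [simp]: "x \<in> D \<Longrightarrow> cj 0 x = x"
  by (simp add: cj_def)

lemma cj_1: "cj 1 x = s \<otimes> x \<otimes> inv s"
  by (simp add: cj_def)

text \<open>The conjugation action on \<open>D\<close> factors through the abelianization, so \<open>r\<close> commutes past
  the conjugation by powers of \<open>s\<close>.\<close>

lemma r_cj_r:
  assumes x: "x \<in> D"
  shows "r \<otimes> cj k x \<otimes> r = cj k (r \<otimes> x \<otimes> r)"
proof -
  let ?t = "s [^] k"
  let ?u = "r \<otimes> ?t \<otimes> inv r \<otimes> inv ?t"
  let ?y = "cj k (r \<otimes> x \<otimes> r)"
  have u: "?u \<in> D" by (rule commutator_in_D) simp_all
  have y: "?y \<in> D" using D_conj[of r x] x by (simp add: inv_r)
  \<comment> \<open>Moving \<open>r\<close> past the power of \<open>s\<close> costs the commutator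
    \<open>?u\<close>, which lies in the abelian group \<open>D\<close> and so acts trivially on it
    by conjugation.\<close>
  have "r \<otimes> cj k x \<otimes> r = ?u \<otimes> ?y \<otimes> inv ?u"
    using x by (simp add: cj_def inv_r r_square r_cancel group_word_simps)
  also have "\<dots> = ?y" using D_comm[OF u y] u y by (simp add: m_assoc)
  finally show ?thesis .
qed

lemma r_cj_c_r: "r \<otimes> cj k c \<otimes> r = inv (cj k c)"
  using r_cj_r[of c k] r_c_r by (simp add: cj_inv m_assoc)

lemma r_cj_d_r: "r \<otimes> cj k d \<otimes> r = inv (cj k d)"
proof -
  have "r \<otimes> d \<otimes> r = inv d"
    by (simp add: d_def inv_r r_square r_cancel group_word_simps)
  then show ?thesis using r_cj_r[of d k] by (simp add: cj_inv)
qed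

lemma cj_c_cube: "cj k c \<otimes> (cj k c \<otimes> cj k c) = \<one>"
  using c_cube by (simp flip: cj_mult) (simp add: cj_def)

text \<open>Both sides of the braid relation are a product of conjugates of \<open>c\<close> and its
  inverse, followed by s^3. Cancelling s^3 leaves an equation in \<open>D\<close> that is solved for
  the third conjugate; conjugating by powers of \<open>s\<close> then gives every
  \<open>k\<close>.\<close>

lemma cj_c_recurrence: "cj (k + 3) c = cj k c \<otimes> cj (k + 1) c \<otimes> inv (cj (k + 2) c)"
proof -
  interpret H: comm_group H by (rule comm_group_H)
  define f where "f = cj 1"
  have fD [simp]: "f x \<in> D" if "x \<in> D" for x using that by (simp add: f_def)
  have f1: "f c = s \<otimes> (c \<otimes> inv s)"
    by (simp add: f_def cj_1 m_assoc)
  have f2: "f (f c) = s \<otimes> (s \<otimes> (c \<otimes> (inv s \<otimes> inv s)))"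
    unfolding f_def cj_1 by (simp add: m_assoc)
  have f3: "f (f (f c)) = s \<otimes> (s \<otimes> (s \<otimes> (c \<otimes> (inv s \<otimes> (inv s \<otimes> inv s)))))"
    unfolding f_def cj_1 by (simp add: m_assoc)
  have "f c \<otimes> inv (f (f c)) \<otimes> (s \<otimes> (s \<otimes> s)) = s \<otimes> ((c \<otimes> s \<otimes> inv c) \<otimes> s)"
    unfolding f2 unfolding f1 by (simp add: group_word_simps)
  also have "\<dots> = c \<otimes> inv (f c) \<otimes> f (f c) \<otimes> inv (f (f (f c))) \<otimes> (s \<otimes> (s \<otimes> s))"
    unfolding braid f3 unfolding f2 unfolding f1 by (simp add: group_word_simps)
  finally have "f c \<otimes> inv (f (f c)) = c \<otimes> inv (f c) \<otimes> f (f c) \<otimes> inv (f (f (f c)))"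
    by simp
  moreover have "f c \<otimes> (f c \<otimes> f c) = \<one>" "f (f c) \<otimes> (f (f c) \<otimes> f (f c)) = \<one>"
    using cj_c_cube[of 1] cj_c_cube[of 2] by (simp_all add: f_def cj_cj)
  ultimately have "f (f (f c)) = c \<otimes> f c \<otimes> inv (f (f c))"
    using H.solve_braid_relation[of c "f c" "f (f c)" "f (f (f c))"] by simp
  then have "cj 3 c = c \<otimes> cj 1 c \<otimes> inv (cj 2 c)" by (simp add: f_def cj_cj)
  then have "cj k (cj 3 c) = cj k (c \<otimes> cj 1 c \<otimes> inv (cj 2 c))" by simp
  then show ?thesis by (simp add: cj_mult cj_inv cj_cj)
qed

text \<open>The generated subgroup is normal: \<open>s\<close> shifts the index of a conjugate,
  \<open>r\<close> inverts it, and \<open>c\<close> fixes it because \<open>D\<close> is abelian. It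
  also contains the commutators of \<open>s\<close>, \<open>r\<close> and \<open>c\<close>, so it
  contains \<open>D\<close>.\<close>

lemma D_eq_generate: "D = generate G (range (\<lambda>k. cj k c) \<union> range (\<lambda>k. cj k d))"
proof
  let ?S = "range (\<lambda>k. cj k c) \<union> range (\<lambda>k. cj k d)"
  let ?N = "generate G ?S"
  have S: "?S \<subseteq> D" by auto
  then show "?N \<subseteq> D"
    by (rule generate_subgroup_incl) (rule subgroup_D)
  have SG: "?S \<subseteq> carrier G" using S by auto
  have Nc: "cj k c \<in> ?N" and Nd: "cj k d \<in> ?N" for k by (auto intro: generate.incl)
  have Ninv: "inv x \<in> ?N" if "x \<in> ?N" for x using generate_m_inv_closed[OF SG that] .
  have s1: "s \<otimes> cj k x \<otimes> inv s = cj (k + 1) x" "inv s \<otimes> cj k x \<otimes> s = cj (k - 1) x" if "x \<in> D" for k x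
  proof -
    show "s \<otimes> cj k x \<otimes> inv s = cj (k + 1) x"
      using cj_cj[OF that, of 1 k] by (simp add: cj_1 add.commute)
    have "inv s \<otimes> cj k x \<otimes> s = cj (- 1) (cj k x)"
      by (simp add: cj_def int_pow_neg)
    then show "inv s \<otimes> cj k x \<otimes> s = cj (k - 1) x"
      using cj_cj[OF that, of "- 1" k] by simp
  qed
  have c1: "c \<otimes> x \<otimes> inv c = x" "inv c \<otimes> x \<otimes> c = x" if "x \<in> D" for x
    using that D_comm[of c x] D_comm[of "inv c" x] by (simp_all add: m_assoc)
  have "?N \<lhd> G"
  proof (rule normal_generate_if_conj_generators[OF SG _ generators])
    show "{s, r, c} \<subseteq> carrier G" by simp
    fix t x assume t: "t \<in> {s, r, c}" and "x \<in> ?S"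
    then obtain k where "x = cj k c \<or> x = cj k d" by auto
    then show "t \<otimes> x \<otimes> inv t \<in> ?N" "inv t \<otimes> x \<otimes> t \<in> ?N"
      using t Nc[of k] Nd[of k] Nc[of "k + 1"] Nd[of "k + 1"] Nc[of "k - 1"] Nd[of "k - 1"]
        Ninv[OF Nc[of k]] Ninv[OF Nd[of k]]
      by (auto simp: s1 c1 inv_r r_cj_c_r r_cj_d_r)
  qed
  show "D \<subseteq> ?N"
    unfolding D_def
  proof (rule derived_subset_if_generators_commute[OF _ generators \<open>?N \<lhd> G\<close>])
    have inv_comm: "y \<otimes> x \<otimes> inv y \<otimes> inv x = inv (x \<otimes> y \<otimes> inv x \<otimes> inv y)"
      if "x \<in> carrier G" "y \<in> carrier G" for x y
      using that by (simp add: group_word_simps)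
    have rs: "s \<otimes> r \<otimes> inv s \<otimes> inv r \<in> ?N" using Nd[of 0] inv_r by (simp add: d_def[symmetric])
    have rc: "r \<otimes> c \<otimes> inv r \<otimes> inv c \<in> ?N" using Nc[of 0] by (simp add: r_c_commutator)
    have sc: "s \<otimes> c \<otimes> inv s \<otimes> inv c \<in> ?N"
      using generate.eng[OF Nc[of 1] Ninv[OF Nc[of 0]]] by (simp add: cj_1)
    have xx: "x \<otimes> x \<otimes> inv x \<otimes> inv x \<in> ?N" if "x \<in> carrier G" for x
      using that generate.one[of G ?S] by (simp add: m_assoc)
    fix x y assume "x \<in> {s, r, c}" "y \<in> {s, r, c}"
    then show "x \<otimes> y \<otimes> inv x \<otimes> inv y \<in> ?N"
      using rs rc sc xx inv_comm[of s r] inv_comm[of s c] inv_comm[of r c]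
        Ninv[OF rs] Ninv[OF rc] Ninv[OF sc] by auto
  qed simp
qed

text \<open>By the recurrence, three consecutive conjugates of \<open>c\<close> give all of them.\<close>

lemma D_subset_subgroup:
  assumes A: "subgroup A H" and "c \<in> A" "cj 1 c \<in> A" "cj 2 c \<in> A" and dA: "\<And>k. cj k d \<in> A"
  shows "D \<subseteq> A"
proof -
  have mult: "x \<otimes> y \<in> A" if "x \<in> A" "y \<in> A" for x y
    using subgroup.m_closed[OF A that] by simp
  have AD: "x \<in> D" if "x \<in> A" for x using subgroup.mem_carrier[OF A that] by simp
  have inv: "inv x \<in> A" if "x \<in> A" for x
    using subgroup.m_inv_closed[OF A that] AD[OF that] by simp
  have AG: "subgroup A G"
    using A AD mult inv subgroup.one_closed[OF A] by (intro subgroupI) auto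
  have "cj k c \<in> A \<and> cj (k + 1) c \<in> A \<and> cj (k + 2) c \<in> A" for k
  proof (induction k rule: int_induct[where k = 0])
    case base
    then show ?case using assms by simp
  next
    case (step1 i)
    then show ?case using cj_c_recurrence[of i] mult inv by (simp add: add.assoc)
  next
    case (step2 i)
    let ?a = "cj (i - 1) c" and ?b = "cj i c" and ?e = "cj (i + 1) c" and ?f = "cj (i + 2) c"
    have "?f = ?a \<otimes> ?b \<otimes> inv ?e" using cj_c_recurrence[of "i - 1"] by (simp add: algebra_simps)
    \<comment> \<open>Solving the recurrence for its first term carries the induction to negative
      indices.\<close>
    then have "?a = ?f \<otimes> ?e \<otimes> inv ?b" by (simp add: group_word_simps)
    moreover have "i - 1 + 1 = i" "i - 1 + 2 = i + 1" by simp_all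
    ultimately show ?case using step2 mult inv by metis
  qed
  then show ?thesis
    unfolding D_eq_generate using dA by (intro generate_subgroup_incl[OF _ AG]) auto
qed

end

text \<open>A solution of \<open>u(j+3) = u(j) + u(j+1) - u(j+2)\<close> over the field with three elements, whose
  shifts by 0, 1, 2 are linearly independent.\<close>

definition hexaperiodic :: "int \<Rightarrow> 3" where
  "hexaperiodic j = (let m = j mod 6 in if m = 2 \<or> m = 5 then 1 else if m = 3 \<or> m = 4 then - 1 else 0)"

lemma hexaperiodic_values [simp]:
  "hexaperiodic 0 = 0" "hexaperiodic 1 = 0" "hexaperiodic 2 = 1" "hexaperiodic 3 = - 1" "hexaperiodic 4 = - 1"
  by (simp_all add: hexaperiodic_def Let_def)

lemma three_eq_0: "x + x + x = (0 :: 3)"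
proof -
  have "x + x + x = of_nat CHAR(3) * x" by (simp add: algebra_simps)
  then show ?thesis by (simp only: of_nat_CHAR mult_zero_left)
qed

lemma hexaperiodic_recurrence:
  "hexaperiodic (j + 3) = hexaperiodic j + hexaperiodic (j + 1) - hexaperiodic (j + 2)"
proof -
  obtain e :: 3 where e: "e = 1" by simp
  define f where "f m = (if m = 2 \<or> m = 5 then e else if m = 3 \<or> m = 4 then - e else 0)" for m :: int
  have f: "hexaperiodic (j + a) = f ((j mod 6 + a) mod 6)" for a
    by (simp add: hexaperiodic_def f_def e Let_def mod_add_left_eq)
  have vals: "f 0 = 0" "f 1 = 0" "f 2 = e" "f 3 = - e" "f 4 = - e" "f 5 = e"
    by (simp_all add: f_def)
  have "- (e + e + e) = 0" "e + e + e = 0"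
    by (simp_all only: three_eq_0 minus_zero)
  \<comment> \<open>Only the residues 3 and 1 modulo 6 need characteristic three, through these two
    equations; the other four cases hold in any abelian group.\<close>
  then have "0 = - e + - e - e" "- e = 0 + e - - e"
    by (simp_all only: minus_add_distrib diff_conv_add_uminus neg_eq_iff_add_eq_0 minus_minus
      add_0_left add.assoc)
  then have step: "f ((m + 3) mod 6) = f ((m + 0) mod 6) + f ((m + 1) mod 6) - f ((m + 2) mod 6)"
    if "m = 0 \<or> m = 1 \<or> m = 2 \<or> m = 3 \<or> m = 4 \<or> m = 5" for m
    using that by (elim disjE) (simp_all only: vals, simp_all add: vals del: diff_minus_eq_add)
  have "j mod 6 = 0 \<or> j mod 6 = 1 \<or> j mod 6 = 2 \<or> j mod 6 = 3 \<or> j mod 6 = 4 \<or> j mod 6 = 5"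
    by arith
  from step[OF this] show ?thesis using f[of 0] f by simp
qed

lemma of_int_3_eq_0_iff:
  assumes "0 \<le> i" "i < 3" "of_int i = (0 :: 3)"
  shows "i = 0"
proof -
  have "(2 :: 3) \<noteq> 0"
  proof
    assume "(2 :: 3) = 0"
    then show False using three_eq_0[of 1] by simp
  qed
  moreover have "i = 0 \<or> i = 1 \<or> i = 2" using assms(1,2) by arith
  ultimately show ?thesis using assms(3) by auto
qed

text \<open>The initial values 0, 0, 1 make the system triangular: evaluating at 0, 1, 2 isolates
  \<open>l\<close>, then \<open>j\<close>, then \<open>i\<close>.\<close>

lemma hexaperiodic_independent:
  assumes "0 \<le> i" "i < 3" "0 \<le> j" "j < 3" "0 \<le> l" "l < 3"
    and "\<And>m. of_int i * hexaperiodic m + (of_int j * hexaperiodic (m + 1)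
      + of_int l * hexaperiodic (m + 2)) = 0"
  shows "i = 0 \<and> j = 0 \<and> l = 0"
proof -
  have "l = 0" using assms(7)[of 0] assms by (simp add: of_int_3_eq_0_iff)
  moreover from this have "j = 0" using assms(7)[of 1] assms by (simp add: of_int_3_eq_0_iff)
  ultimately show ?thesis using assms(7)[of 2] assms by (simp add: of_int_3_eq_0_iff)
qed

section \<open>Homomorphisms to the signed shift group and the structure of D\<close>

context metabelian_triple
begin

lemma hom_D:
  assumes h: "h \<in> hom G signed_shift" and x: "x \<in> D"
  shows "h x = (fst (h x), 0, False)"
proof -
  interpret S: group signed_shift by (rule group_signed_shift)
  interpret h: group_hom G signed_shift h by unfold_locales fact
  have "h x \<in> derived signed_shift (h ` carrier G)"
    using h.derived_img[of "carrier G"] x by (auto simp: D_def)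
  also have "\<dots> \<subseteq> derived signed_shift UNIV" by (rule S.mono_derived) simp_all
  finally show ?thesis using derived_signed_shift by (auto simp: prod_eq_iff)
qed

lemma fst_hom_mult:
  assumes "h \<in> hom G signed_shift" "x \<in> D" "y \<in> D"
  shows "fst (h (x \<otimes> y)) m = fst (h x) m + fst (h y) m"
proof -
  have "h (x \<otimes> y) = h x \<otimes>\<^bsub>signed_shift\<^esub> h y" using assms by (simp add: hom_mult)
  also have "\<dots> = (fst (h x), 0, False) \<otimes>\<^bsub>signed_shift\<^esub> (fst (h y), 0, False)"
    using hom_D assms by metis
  finally show ?thesis by simp
qed

lemma fst_hom_int_pow:
  fixes h :: "'a \<Rightarrow> (int \<Rightarrow> 'e::ring_1) \<times> int \<times> bool"
  assumes "h \<in> hom G signed_shift" "x \<in> D"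
  shows "fst (h (x [^]\<^bsub>H\<^esub> (i :: int))) m = of_int i * fst (h x) m"
proof -
  interpret H: comm_group H by (rule comm_group_H)
  show ?thesis
    by (rule H.additive_int_pow) (use assms fst_hom_mult[OF assms(1)] in auto)
qed

text \<open>Conjugation by \<open>(v, 1, False)\<close> translates the argument of a function by
  one, and the contribution of \<open>v\<close> cancels.\<close>

lemma fst_hom_cj:
  assumes h: "h \<in> hom G signed_shift" "h s = (v, 1, False)" and x: "x \<in> D"
  shows "fst (h (cj k x)) m = fst (h x) (m + k)"
proof -
  interpret S: group signed_shift by (rule group_signed_shift)
  interpret h: group_hom G signed_shift h by unfold_locales fact
  have one: "fst (h (cj 1 x)) m = fst (h x) (m + 1)" if "x \<in> D" for x m
  proof -
    have "h (cj 1 x) = (v, 1, False) \<otimes>\<^bsub>signed_shift\<^esub> (fst (h x), 0, False) \<otimes>\<^bsub>signed_shift\<^esub>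
        inv\<^bsub>signed_shift\<^esub> (v, 1, False)"
      using that h(2) hom_D[OF h(1) that] by (simp add: cj_1)
    then show ?thesis by simp
  qed
  show ?thesis
  proof (induction k arbitrary: m rule: int_induct[where k = 0])
    case base
    then show ?case using x by simp
  next
    case (step1 i)
    have "cj (i + 1) x = cj 1 (cj i x)" using x by (simp add: cj_cj add.commute)
    then show ?case using one[of "cj i x" m] step1(2)[of "m + 1"] x by (simp add: algebra_simps)
  next
    case (step2 i)
    have "cj 1 (cj (i - 1) x) = cj i x" using x by (simp add: cj_cj)
    then show ?case using one[of "cj (i - 1) x" "m - 1"] step2(2)[of "m - 1"] x
      by (simp add: algebra_simps)
  qed
qed

abbreviation "c0_pow i \<equiv> c [^]\<^bsub>H\<^esub> (i :: int)"
abbreviation "c1_pow i \<equiv> cj 1 c [^]\<^bsub>H\<^esub> (i :: int)"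
abbreviation "c2_pow i \<equiv> cj 2 c [^]\<^bsub>H\<^esub> (i :: int)"

lemma c_pow_hom:
  "c0_pow \<in> hom Z3 H" "c1_pow \<in> hom Z3 H" "c2_pow \<in> hom Z3 H"
proof -
  interpret H: comm_group H by (rule comm_group_H)
  have "cj k c [^]\<^bsub>H\<^esub> (3 :: nat) = \<one>\<^bsub>H\<^esub>" for k
    using cj_c_cube[of k] by (simp add: numeral_3_eq_3 m_assoc)
  then have "(\<lambda>i. cj k c [^]\<^bsub>H\<^esub> (i :: int)) \<in> hom Z3 H" for k
    by (intro H.hom_int_pow_mod) simp_all
  from this[of 0] this[of 1] this[of 2]
  show "c0_pow \<in> hom Z3 H" "c1_pow \<in> hom Z3 H" "c2_pow \<in> hom Z3 H" by simp_all
qed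

lemma c_pow_in_D [simp]: "c0_pow i \<in> D" "c1_pow i \<in> D" "c2_pow i \<in> D"
proof -
  interpret H: comm_group H by (rule comm_group_H)
  show "c0_pow i \<in> D" "c1_pow i \<in> D" "c2_pow i \<in> D"
    using H.int_pow_closed[of c i] H.int_pow_closed[of "cj 1 c" i] H.int_pow_closed[of "cj 2 c" i]
    by simp_all
qed

lemma c_pow_1 [simp]: "c0_pow 1 = c" "c1_pow 1 = cj 1 c" "c2_pow 1 = cj 2 c"
proof -
  interpret H: comm_group H by (rule comm_group_H)
  show "c0_pow 1 = c" "c1_pow 1 = cj 1 c" "c2_pow 1 = cj 2 c" by simp_all
qed

text \<open>Powers of three consecutive conjugates of \<open>c\<close> and products of conjugates of
  \<open>d\<close> map onto \<open>D\<close> by the recurrence. For injectivity, \<open>h1\<close>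
  kills the conjugates of \<open>d\<close> and detects the exponents modulo 3; then
  \<open>h2\<close> detects the free part.\<close>

lemma H_iso_times_free:
  assumes h1: "h1 \<in> hom G signed_shift" "h1 s = (\<lambda>_. 0, 1, False)" "h1 r = (\<lambda>_. 0, 0, True)"
      "h1 c = (hexaperiodic, 0, False)"
    and h2: "h2 \<in> hom G signed_shift" "h2 s = (\<lambda>j. if j = 0 then 1 else 0 :: int, 1, False)"
      "h2 r = (\<lambda>_. 0, 0, True)" "h2 c = (\<lambda>_. 0, 0, False)"
  shows "H \<cong> Z3 \<times>\<times> Z3 \<times>\<times> Z3 \<times>\<times> free_Abelian_group (UNIV :: int set)"
proof -
  interpret H: comm_group H by (rule comm_group_H)
  interpret S: group "signed_shift :: ((int \<Rightarrow> 'e::ab_group_add) \<times> int \<times> bool) monoid"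
    by (rule group_signed_shift)
  interpret h1: group_hom G signed_shift h1 by unfold_locales fact
  interpret h2: group_hom G signed_shift h2 by unfold_locales fact
  let ?F = "free_Abelian_group (UNIV :: int set)"
  have "range (\<lambda>k. cj k d) \<subseteq> carrier H" by auto
  then obtain g where g: "g \<in> hom ?F H" "\<And>k. g (frag_of k) = cj k d"
    using H.free_Abelian_group_universal[of "\<lambda>k. cj k d" UNIV] by auto
  interpret g: group_hom ?F H g
    by (simp add: group_hom_def group_hom_axioms_def g(1) H.group_axioms)
  have gD [simp]: "g f \<in> D" for f using g.hom_closed[of f] by simp
  have gdiff: "g (a - b) \<otimes> g b = g a" for a b
    using g.hom_mult[of "a - b" b] by simp
  let ?p = "\<lambda>(i, j, l, f). c0_pow i \<otimes>\<^bsub>H\<^esub> (c1_pow j \<otimes>\<^bsub>H\<^esub> (c2_pow l \<otimes>\<^bsub>H\<^esub> g f))"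
  have p: "?p \<in> hom (Z3 \<times>\<times> Z3 \<times>\<times> Z3 \<times>\<times> ?F) H"
    using H.hom_DirProd_mult[OF c_pow_hom(1) H.hom_DirProd_mult[OF c_pow_hom(2)
      H.hom_DirProd_mult[OF c_pow_hom(3) g(1)]]]
    by (simp add: case_prod_unfold)
  have d1: "fst (h1 d) m = 0" for m
    using h1 by (simp add: d_def)
  \<comment> \<open>Conjugation by \<open>r\<close> negates functions, so the commutator doubles the
    delta function that is the first component of \<open>h2 s\<close>. The factor 2 does not hurt
    injectivity, as \<int> is torsion-free.\<close>
  have d2: "fst (h2 d) m = (if m = 0 then 2 else 0)" for m
    using h2 by (simp add: d_def)
  have g1: "fst (h1 (g f)) m = 0" for f m
    using subset_UNIV[of "Poly_Mapping.keys f"]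
  proof (induction f rule: frag_induction)
    case zero
    then show ?case using g.hom_one h1.hom_one by simp
  next
    case (diff a b)
    then show ?case using fst_hom_mult[OF h1(1), of "g (a - b)" "g b" m] by (simp add: gdiff)
  next
    case (one k)
    then show ?case by (simp add: g(2) fst_hom_cj[OF h1(1,2)] d1)
  qed
  \<comment> \<open>The image of \<open>cj k d\<close> is supported at \<open>- k\<close>, which is
    where the coefficient of \<open>k\<close> is read off.\<close>
  have g2: "fst (h2 (g f)) m = 2 * Poly_Mapping.lookup f (- m)" for f m
    using subset_UNIV[of "Poly_Mapping.keys f"]
  proof (induction f rule: frag_induction)
    case zero
    then show ?case using g.hom_one h2.hom_one by simp
  next
    case (diff a b)
    then show ?case using fst_hom_mult[OF h2(1), of "g (a - b)" "g b" m]
      by (simp add: gdiff lookup_minus)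
  next
    case (one k)
    then show ?case by (auto simp: g(2) fst_hom_cj[OF h2(1,2)] d2 lookup_single when_def)
  qed
  have group_P: "group (Z3 \<times>\<times> Z3 \<times>\<times> Z3 \<times>\<times> ?F)"
    by (intro DirProd_group) simp_all
  interpret p: group_hom "Z3 \<times>\<times> Z3 \<times>\<times> Z3 \<times>\<times> ?F" H ?p
    using group_P p by (simp add: group_hom_def group_hom_axioms_def H.group_axioms)
  have "?p \<in> iso (Z3 \<times>\<times> Z3 \<times>\<times> Z3 \<times>\<times> ?F) H"
    unfolding p.iso_iff
  proof
    let ?A = "?p ` carrier (Z3 \<times>\<times> Z3 \<times>\<times> Z3 \<times>\<times> ?F)"
    have A: "x \<in> ?A"
      if "x = c0_pow i \<otimes> (c1_pow j \<otimes> (c2_pow l \<otimes> g f))" "i \<in> {0..<3}" "j \<in> {0..<3}" "l \<in> {0..<3}"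
      for x i j l f
      using that by (intro image_eqI[of _ _ "(i, j, l, f)"]) (simp_all add: carrier_integer_mod_group)
    have g0: "g 0 = \<one>" using g.hom_one by simp
    have pow0: "c0_pow 0 = \<one>" "c1_pow 0 = \<one>" "c2_pow 0 = \<one>" by simp_all
    note [simp] = g0 pow0
    have "D \<subseteq> ?A"
    proof (rule D_subset_subgroup)
      show "subgroup ?A H" by (rule p.img_is_subgroup)
      show "c \<in> ?A" by (rule A[of _ 1 0 0 0]) simp_all
      show "cj 1 c \<in> ?A" by (rule A[of _ 0 1 0 0]) simp_all
      show "cj 2 c \<in> ?A" by (rule A[of _ 0 0 1 0]) simp_all
      show "cj k d \<in> ?A" for k by (rule A[of _ 0 0 0 "frag_of k"]) (simp_all add: g(2))
    qed
    then show "carrier H \<subseteq> ?A" by simp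
    show "\<forall>x\<in>carrier (Z3 \<times>\<times> Z3 \<times>\<times> Z3 \<times>\<times> ?F). ?p x = \<one>\<^bsub>H\<^esub> \<longrightarrow> x = \<one>\<^bsub>Z3 \<times>\<times> Z3 \<times>\<times> Z3 \<times>\<times> ?F\<^esub>"
    proof (intro ballI impI)
      fix x assume x: "x \<in> carrier (Z3 \<times>\<times> Z3 \<times>\<times> Z3 \<times>\<times> ?F)" and px: "?p x = \<one>\<^bsub>H\<^esub>"
      obtain i j l f where xe: "x = (i, j, l, f)" by (metis prod.exhaust)
      have eq: "c0_pow i \<otimes> (c1_pow j \<otimes> (c2_pow l \<otimes> g f)) = \<one>" using px xe by simp
      have "fst (h1 (c0_pow i \<otimes> (c1_pow j \<otimes> (c2_pow l \<otimes> g f)))) m = 0" for m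
        unfolding eq using h1.hom_one by simp
      then have "of_int i * hexaperiodic m + (of_int j * hexaperiodic (m + 1)
          + of_int l * hexaperiodic (m + 2)) = 0" for m
        by (simp add: fst_hom_mult[OF h1(1)] fst_hom_int_pow[OF h1(1)] fst_hom_cj[OF h1(1,2)] g1 h1(4) del: h1.hom_mult)
      then have ijl: "i = 0 \<and> j = 0 \<and> l = 0"
        using x by (intro hexaperiodic_independent) (simp_all add: xe carrier_integer_mod_group)
      have "g f = \<one>" using eq ijl by simp
      then have "fst (h2 (g f)) (- m) = 0" for m using h2.hom_one by simp
      then have "f = 0" unfolding g2 by (intro poly_mapping_eqI) simp
      then show "x = \<one>\<^bsub>Z3 \<times>\<times> Z3 \<times>\<times> Z3 \<times>\<times> ?F\<^esub>" using ijl xe by simp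
    qed
  qed
  then show ?thesis
    using group.iso_sym[OF group_P] unfolding is_iso_def by blast
qed

text \<open>With \<open>d\<close> trivial all its conjugates are trivial, and the exponents of the
  conjugates of \<open>c\<close> are detected by \<open>h1\<close> alone.\<close>

lemma H_iso_Z3_cubed:
  assumes h1: "h1 \<in> hom G signed_shift" "h1 s = (\<lambda>_. 0, 1, False)" "h1 c = (hexaperiodic, 0, False)"
    and d: "d = \<one>"
  shows "H \<cong> Z3 \<times>\<times> Z3 \<times>\<times> Z3"
proof -
  interpret H: comm_group H by (rule comm_group_H)
  interpret S: group "signed_shift :: ((int \<Rightarrow> 'e::ab_group_add) \<times> int \<times> bool) monoid"
    by (rule group_signed_shift)
  interpret h1: group_hom G signed_shift h1 by unfold_locales fact
  let ?p = "\<lambda>(i, j, l). c0_pow i \<otimes>\<^bsub>H\<^esub> (c1_pow j \<otimes>\<^bsub>H\<^esub> c2_pow l)"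
  have p: "?p \<in> hom (Z3 \<times>\<times> Z3 \<times>\<times> Z3) H"
    using H.hom_DirProd_mult[OF c_pow_hom(1) H.hom_DirProd_mult[OF c_pow_hom(2,3)]]
    by (simp add: case_prod_unfold)
  have group_P: "group (Z3 \<times>\<times> Z3 \<times>\<times> Z3)"
    by (intro DirProd_group) simp_all
  interpret p: group_hom "Z3 \<times>\<times> Z3 \<times>\<times> Z3" H ?p
    using group_P p by (simp add: group_hom_def group_hom_axioms_def H.group_axioms)
  have "?p \<in> iso (Z3 \<times>\<times> Z3 \<times>\<times> Z3) H"
    unfolding p.iso_iff
  proof
    let ?A = "?p ` carrier (Z3 \<times>\<times> Z3 \<times>\<times> Z3)"
    have A: "x \<in> ?A"
      if "x = c0_pow i \<otimes> (c1_pow j \<otimes> c2_pow l)" "i \<in> {0..<3}" "j \<in> {0..<3}" "l \<in> {0..<3}"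
      for x i j l
      using that by (intro image_eqI[of _ _ "(i, j, l)"]) (simp_all add: carrier_integer_mod_group)
    have pow0: "c0_pow 0 = \<one>" "c1_pow 0 = \<one>" "c2_pow 0 = \<one>" by simp_all
    note [simp] = pow0
    have "D \<subseteq> ?A"
    proof (rule D_subset_subgroup)
      show "subgroup ?A H" by (rule p.img_is_subgroup)
      show "c \<in> ?A" by (rule A[of _ 1 0 0]) simp_all
      show "cj 1 c \<in> ?A" by (rule A[of _ 0 1 0]) simp_all
      show "cj 2 c \<in> ?A" by (rule A[of _ 0 0 1]) simp_all
      show "cj k d \<in> ?A" for k by (rule A[of _ 0 0 0]) (simp_all add: d cj_def)
    qed
    then show "carrier H \<subseteq> ?A" by simp
    show "\<forall>x\<in>carrier (Z3 \<times>\<times> Z3 \<times>\<times> Z3). ?p x = \<one>\<^bsub>H\<^esub> \<longrightarrow> x = \<one>\<^bsub>Z3 \<times>\<times> Z3 \<times>\<times> Z3\<^esub>"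
    proof (intro ballI impI)
      fix x assume x: "x \<in> carrier (Z3 \<times>\<times> Z3 \<times>\<times> Z3)" and px: "?p x = \<one>\<^bsub>H\<^esub>"
      obtain i j l where xe: "x = (i, j, l)" by (metis prod.exhaust)
      have eq: "c0_pow i \<otimes> (c1_pow j \<otimes> c2_pow l) = \<one>" using px xe by simp
      have "fst (h1 (c0_pow i \<otimes> (c1_pow j \<otimes> c2_pow l))) m = 0" for m
        unfolding eq using h1.hom_one by simp
      then have "of_int i * hexaperiodic m + (of_int j * hexaperiodic (m + 1)
          + of_int l * hexaperiodic (m + 2)) = 0" for m
        by (simp add: fst_hom_mult[OF h1(1)] fst_hom_int_pow[OF h1(1)] fst_hom_cj[OF h1(1,2)] h1(3)
            del: h1.hom_mult)
      then have "i = 0 \<and> j = 0 \<and> l = 0"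
        using x by (intro hexaperiodic_independent) (simp_all add: xe carrier_integer_mod_group)
      then show "x = \<one>\<^bsub>Z3 \<times>\<times> Z3 \<times>\<times> Z3\<^esub>" using xe by simp
    qed
  qed
  then show ?thesis
    using group.iso_sym[OF group_P] unfolding is_iso_def by blast
qed

end

section \<open>The metabelian quotients of the virtual braid groups\<close>

text \<open>The target has trivial second derived subgroup, so \<open>K\<close> lies in the kernel
  of \<open>h\<close>.\<close>

lemma (in group) signed_shift_hom_Mod:
  fixes K defines "K \<equiv> derived G (derived G (carrier G))"
  assumes h: "h \<in> hom G signed_shift"
  obtains g where "g \<in> hom (G Mod K) signed_shift"
    and "\<And>x. x \<in> carrier G \<Longrightarrow> g (K #> x) = h x"
proof -
  interpret S: group signed_shift by (rule group_signed_shift)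
  interpret h: group_hom G signed_shift h by unfold_locales fact
  have D: "derived G (carrier G) \<subseteq> carrier G" by (rule derived_in_carrier) simp
  have K: "K \<lhd> G" unfolding K_def by (rule derived_Mod_eq_derived_metabelian(1))
  then have KG: "K \<subseteq> carrier G" using normal_imp_subgroup subgroup.subset by blast
  have "h ` K = derived signed_shift (derived signed_shift (h ` carrier G))"
    unfolding K_def using h.derived_img[OF D] h.derived_img[of "carrier G"] by simp
  also have "\<dots> \<subseteq> derived signed_shift (derived signed_shift UNIV)"
    by (intro S.mono_derived) simp_all
  finally have "K \<subseteq> kernel G signed_shift h"
    using KG unfolding derived_derived_signed_shift by (auto simp: kernel_def)
  then show thesis using h.FactGroup_universal_kernel[OF K] that by blast
qed

section \<open>Coincidences among the generators when the derived subgroup is abelian\<close>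

locale metabelian_vb = vb_generators +
  assumes metabelian: "x \<in> derived G (carrier G) \<Longrightarrow> y \<in> derived G (carrier G) \<Longrightarrow> x \<otimes> y = y \<otimes> x"
begin

lemma inv_rho: "i \<in> {1..n-1} \<Longrightarrow> inv (\<rho> i) = \<rho> i"
  using rho_square rho_closed by (metis inv_equality)

lemma rho_cancel: "i \<in> {1..n-1} \<Longrightarrow> x \<in> carrier G \<Longrightarrow> \<rho> i \<otimes> (\<rho> i \<otimes> x) = x"
  using inv_mult_cancel_left(2)[of "\<rho> i" x] rho_closed by (simp add: inv_rho)

text \<open>Regrouped, the cube is the product of the two sides of the braid relation, hence the
  square of a conjugate of an involution.\<close>

lemma rho_rho_cube:
  assumes "i \<in> {1..n-2}"
  shows "(\<rho> i \<otimes> \<rho> (i + 1)) \<otimes> ((\<rho> i \<otimes> \<rho> (i + 1)) \<otimes> (\<rho> i \<otimes> \<rho> (i + 1))) = \<one>"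
proof -
  have i: "i \<in> {1..n-1}" "i + 1 \<in> {1..n-1}" using assms by auto
  note [simp del] = One_nat_def
  note [simp] = rho_closed[OF i(1)] rho_closed[OF i(2)]
  have "(\<rho> i \<otimes> \<rho> (i + 1)) \<otimes> ((\<rho> i \<otimes> \<rho> (i + 1)) \<otimes> (\<rho> i \<otimes> \<rho> (i + 1)))
      = (\<rho> i \<otimes> (\<rho> (i + 1) \<otimes> \<rho> i)) \<otimes> (\<rho> (i + 1) \<otimes> (\<rho> i \<otimes> \<rho> (i + 1)))"
    by (simp add: m_assoc)
  also have "\<dots> = (\<rho> i \<otimes> (\<rho> (i + 1) \<otimes> \<rho> i)) \<otimes> (\<rho> i \<otimes> (\<rho> (i + 1) \<otimes> \<rho> i))"
    unfolding rho_braid[OF assms] ..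
  also have "\<dots> = \<one>"
    by (simp add: m_assoc rho_cancel[OF i(1)] rho_cancel[OF i(2)] rho_square[OF i(1)])
  finally show ?thesis .
qed

text \<open>The commutator of the two involutions is the square of their product \<open>?t\<close>,
  and its inverse is \<open>?t\<close> because the cube of \<open>?t\<close> is trivial.\<close>

lemma rho_rho_in_derived:
  assumes "i \<in> {1..n-2}"
  shows "\<rho> i \<otimes> \<rho> (i + 1) \<in> derived G (carrier G)"
proof -
  have i: "i \<in> {1..n-1}" "i + 1 \<in> {1..n-1}" using assms by auto
  note [simp del] = One_nat_def
  note [simp] = rho_closed[OF i(1)] rho_closed[OF i(2)]
  let ?t = "\<rho> i \<otimes> \<rho> (i + 1)"
  have "\<rho> i \<otimes> \<rho> (i + 1) \<otimes> inv (\<rho> i) \<otimes> inv (\<rho> (i + 1)) \<in> derived G (carrier G)"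
    by (rule commutator_in_derived) simp_all
  then have "?t \<otimes> ?t \<in> derived G (carrier G)" by (simp add: inv_rho[OF i(1)] inv_rho[OF i(2)] m_assoc)
  then have "inv (?t \<otimes> ?t) \<in> derived G (carrier G)"
    using subgroup.m_inv_closed[OF derived_is_subgroup] by simp
  moreover have "inv (?t \<otimes> ?t) = ?t"
    using rho_rho_cube[OF assms] by (intro inv_equality) simp_all
  ultimately show ?thesis by simp
qed

text \<open>The product of two commuting involutions is here also a product of two commuting elements
  of order three.\<close>

lemma rho_add_2:
  assumes "i \<ge> 1" "i + 2 \<le> n - 1"
  shows "\<rho> (i + 2) = \<rho> i"
proof -
  have i: "i \<in> {1..n-1}" "i + 1 \<in> {1..n-1}" "i + 2 \<in> {1..n-1}" "i \<in> {1..n-2}" "i + 1 \<in> {1..n-2}"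
    using assms by auto
  note [simp del] = One_nat_def add_2_eq_Suc'
  note [simp] = rho_closed[OF i(1)] rho_closed[OF i(2)] rho_closed[OF i(3)]
  have far: "\<rho> i \<otimes> \<rho> (i + 2) = \<rho> (i + 2) \<otimes> \<rho> i"
    using i by (intro rho_far) (auto simp: far_def)
  define t where "t = \<rho> i \<otimes> \<rho> (i + 1)"
  define u where "u = \<rho> (i + 1) \<otimes> \<rho> (i + 2)"
  have e: "i + 1 + 1 = i + 2" by simp
  have [simp]: "t \<in> carrier G" "u \<in> carrier G" by (simp_all add: t_def u_def)
  have tu: "t \<otimes> u = \<rho> i \<otimes> \<rho> (i + 2)"
    by (simp add: t_def u_def m_assoc rho_cancel[OF i(2)])
  have comm: "t \<otimes> u = u \<otimes> t"
    unfolding t_def u_def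
    by (rule metabelian[OF rho_rho_in_derived[OF i(4)] rho_rho_in_derived[OF i(5), unfolded e]])
  have t3: "t \<otimes> (t \<otimes> t) = \<one>" and u3: "u \<otimes> (u \<otimes> u) = \<one>"
    unfolding t_def u_def by (rule rho_rho_cube[OF i(4)], rule rho_rho_cube[OF i(5), unfolded e])
  have "(t \<otimes> u) \<otimes> (t \<otimes> u) = (\<rho> i \<otimes> \<rho> (i + 2)) \<otimes> (\<rho> (i + 2) \<otimes> \<rho> i)"
    unfolding tu by (simp only: far)
  also have "\<dots> = \<one>" by (simp add: m_assoc rho_cancel[OF i(3)] rho_square[OF i(1)])
  finally have sq: "(t \<otimes> u) \<otimes> (t \<otimes> u) = \<one>" .
  have c2: "u \<otimes> (t \<otimes> x) = t \<otimes> (u \<otimes> x)" if "x \<in> carrier G" for x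
    using that comm by (simp flip: m_assoc)
  \<comment> \<open>An element whose square and cube are both trivial is trivial; the cube splits
    because \<open>t\<close> and \<open>u\<close> commute.\<close>
  have "t \<otimes> u = (t \<otimes> u) \<otimes> ((t \<otimes> u) \<otimes> (t \<otimes> u))" using sq by simp
  also have "\<dots> = (t \<otimes> (t \<otimes> t)) \<otimes> (u \<otimes> (u \<otimes> u))"
    by (simp add: m_assoc c2 comm[symmetric])
  finally have "\<rho> i \<otimes> \<rho> (i + 2) = \<one>" by (simp add: t3 u3 tu)
  then have "\<rho> i \<otimes> (\<rho> i \<otimes> \<rho> (i + 2)) = \<rho> i" by simp
  then show ?thesis by (simp add: rho_cancel[OF i(1)])
qed

text \<open>The three elements recover the remaining generators: \<rho>_2 is \<rho>_1 times
  \<open>?c\<close>, and \<sigma>_2 is the conjugate of \<sigma>_1 by \<open>?c\<close>.\<close>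

lemma metabelian_tripleI:
  assumes "n \<ge> 3"
    and gens: "\<And>i. i \<in> {1..n-1} \<Longrightarrow> \<sigma> i \<in> {\<sigma> 1, \<sigma> 2} \<and> \<rho> i \<in> {\<rho> 1, \<rho> 2}"
  shows "metabelian_triple G (\<sigma> 1) (\<rho> 1) (\<rho> 1 \<otimes> \<rho> 2)"
proof -
  have i: "1 \<in> {1..n-1}" "2 \<in> {1..n-1}" "1 \<in> {1..n-2}" using assms(1) by auto
  note [simp del] = One_nat_def
  note [simp] = rho_closed[OF i(1)] rho_closed[OF i(2)] sigma_closed[OF i(1)] sigma_closed[OF i(2)]
    inv_rho[OF i(1)] inv_rho[OF i(2)] rho_square[OF i(1)] rho_square[OF i(2)]
    rho_cancel[OF i(1)] rho_cancel[OF i(2)]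
  let ?c = "\<rho> 1 \<otimes> \<rho> 2"
  let ?N = "generate G {\<sigma> 1, \<rho> 1, ?c}"
  have "?c \<otimes> \<sigma> 1 = \<sigma> 2 \<otimes> ?c" using mixed_braid[OF i(3)] by (simp add: m_assoc)
  then have s2: "?c \<otimes> \<sigma> 1 \<otimes> inv ?c = \<sigma> 2" by (simp add: m_assoc)
  have sub: "subgroup ?N G" by (rule generate_is_subgroup) simp
  have N: "\<sigma> 1 \<in> ?N" "\<rho> 1 \<in> ?N" "?c \<in> ?N" by (auto intro: generate.incl)
  have "\<rho> 1 \<otimes> ?c \<in> ?N" using N sub subgroup.m_closed by metis
  then have r2: "\<rho> 2 \<in> ?N" by (simp flip: m_assoc)
  have "?c \<otimes> \<sigma> 1 \<otimes> inv ?c \<in> ?N"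
    using N sub subgroup.m_closed subgroup.m_inv_closed by metis
  then have "\<sigma> 2 \<in> ?N" unfolding s2 .
  then have "\<sigma> ` {1..n-1} \<union> \<rho> ` {1..n-1} \<subseteq> ?N" using gens N r2 by fastforce
  then have "carrier G \<subseteq> ?N" using generate_subgroup_incl[OF _ sub] generators by metis
  then have gen: "?N = carrier G" using subgroup.subset[OF sub] by blast
  show ?thesis
  proof
    show "?c \<otimes> (?c \<otimes> ?c) = \<one>" using rho_rho_cube[OF i(3)] by simp
    show "\<rho> 1 \<otimes> (?c \<otimes> \<rho> 1) = inv ?c" by (simp add: group_word_simps)
    show "\<sigma> 1 \<otimes> ((?c \<otimes> \<sigma> 1 \<otimes> inv ?c) \<otimes> \<sigma> 1)
        = (?c \<otimes> \<sigma> 1 \<otimes> inv ?c) \<otimes> (\<sigma> 1 \<otimes> (?c \<otimes> \<sigma> 1 \<otimes> inv ?c))"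
      unfolding s2 using sigma_braid[OF i(3)] by simp
  qed (use gen metabelian in simp_all)
qed

text \<open>Here \<rho>_4 = \<rho>_2 commutes with \<rho>_1, so the braid relation forces \<rho>_1 =
  \<rho>_2 and all \<rho>_i coincide. The mixed braid relations then identify all \<sigma>_i, and
  \<sigma>_1 commutes with \<rho>_3 = \<rho>_1.\<close>

lemma comm_group_if_5_le:
  assumes "n \<ge> 5"
  shows "comm_group G"
proof -
  have i: "1 \<in> {1..n-1}" "2 \<in> {1..n-1}" "3 \<in> {1..n-1}" "4 \<in> {1..n-1}" "1 \<in> {1..n-2}"
    using assms by auto
  note [simp del] = One_nat_def
  note [simp] = rho_closed[OF i(1)] rho_closed[OF i(2)] sigma_closed[OF i(1)]
    rho_square[OF i(1)] rho_square[OF i(2)] rho_cancel[OF i(1)] rho_cancel[OF i(2)]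
  have r3: "\<rho> 3 = \<rho> 1" using rho_add_2[of 1] assms by simp
  have r4: "\<rho> 4 = \<rho> 2" using rho_add_2[of 2] assms by simp
  have r12: "\<rho> 1 \<otimes> \<rho> 2 = \<rho> 2 \<otimes> \<rho> 1"
    using rho_far[OF i(1) i(4)] by (simp add: far_def r4)
  have "\<rho> 1 \<otimes> (\<rho> 2 \<otimes> \<rho> 1) = \<rho> 2 \<otimes> (\<rho> 1 \<otimes> \<rho> 2)"
    using rho_braid[OF i(5)] by simp
  then have "\<rho> 2 \<otimes> \<rho> 1 = \<one>" unfolding r12[symmetric] by (simp add: r12)
  then have "\<rho> 2 \<otimes> (\<rho> 2 \<otimes> \<rho> 1) = \<rho> 2" by simp
  then have r2: "\<rho> 2 = \<rho> 1" by simp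
  have rho: "\<rho> i = \<rho> 1" if "i \<in> {1..n-1}" for i
    using that
  proof (induction i rule: less_induct)
    case (less i)
    show ?case
    proof (cases "i \<le> 2")
      case True
      then have "i = 1 \<or> i = 2" using less.prems by auto
      then show ?thesis using r2 by auto
    next
      case False
      then have "\<rho> (i - 2) = \<rho> 1"
        by (intro less.IH) (use less.prems in auto)
      moreover have "\<rho> (i - 2 + 2) = \<rho> (i - 2)"
        by (rule rho_add_2) (use less.prems False in auto)
      moreover have "i - 2 + 2 = i" using False by simp
      ultimately show ?thesis by metis
    qed
  qed
  have sigma: "i \<le> n - 1 \<Longrightarrow> \<sigma> i = \<sigma> 1" if "1 \<le> i" for i
    using that
  proof (induction i rule: dec_induct)
    case (step i)
    then have j: "i \<in> {1..n-2}" "i \<in> {1..n-1}" "i + 1 \<in> {1..n-1}" by auto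
    note [simp del] = One_nat_def
    note [simp] = sigma_closed[OF j(3)]
    have "\<rho> 1 \<otimes> (\<rho> 1 \<otimes> \<sigma> 1) = \<sigma> (i + 1) \<otimes> (\<rho> 1 \<otimes> \<rho> 1)"
      using mixed_braid[OF j(1)] step j by (simp add: rho[OF j(2)] rho[OF j(3)])
    then show ?case unfolding Suc_eq_plus1 by simp
  qed simp
  have sr: "\<sigma> 1 \<otimes> \<rho> 1 = \<rho> 1 \<otimes> \<sigma> 1"
    using mixed_far[OF i(1) i(3)] by (simp add: far_def r3)
  have im: "\<sigma> ` {1..n-1} \<union> \<rho> ` {1..n-1} \<subseteq> {\<sigma> 1, \<rho> 1}"
  proof (intro Un_least image_subsetI)
    fix i assume "i \<in> {1..n-1}"
    then show "\<sigma> i \<in> {\<sigma> 1, \<rho> 1}" "\<rho> i \<in> {\<sigma> 1, \<rho> 1}"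
      using rho[of i] sigma[of i] by simp_all
  qed
  show ?thesis
  proof (rule comm_group_if_generators_commute[OF _ generators])
    show "\<sigma> ` {1..n-1} \<union> \<rho> ` {1..n-1} \<subseteq> carrier G" using sigma_closed rho_closed by auto
    fix x y assume "x \<in> \<sigma> ` {1..n-1} \<union> \<rho> ` {1..n-1}" "y \<in> \<sigma> ` {1..n-1} \<union> \<rho> ` {1..n-1}"
    then have "x = \<sigma> 1 \<or> x = \<rho> 1" "y = \<sigma> 1 \<or> y = \<rho> 1" using im by blast+
    then show "x \<otimes> y = y \<otimes> x" using sr by auto
  qed
qed

text \<open>Once \<rho>_3 = \<rho>_1, the mixed relations carry \<sigma>_1 to \<sigma>_2 by
  conjugation with \<rho>_1 \<rho>_2 and \<sigma>_2 to \<sigma>_3 by conjugation with its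
  inverse.\<close>

lemma four_strands:
  assumes n: "n = 4"
  shows "\<rho> 3 = \<rho> 1" "\<sigma> 3 = \<sigma> 1" "\<sigma> 1 \<otimes> \<rho> 1 = \<rho> 1 \<otimes> \<sigma> 1"
proof -
  have i: "1 \<in> {1..n-1}" "2 \<in> {1..n-1}" "3 \<in> {1..n-1}" "1 \<in> {1..n-2}" "2 \<in> {1..n-2}"
    using n by auto
  note [simp del] = One_nat_def
  note [simp] = rho_closed[OF i(1)] rho_closed[OF i(2)] sigma_closed[OF i(1)] sigma_closed[OF i(2)]
    sigma_closed[OF i(3)] rho_square[OF i(1)] rho_square[OF i(2)]
    rho_cancel[OF i(1)] rho_cancel[OF i(2)]
  show r3: "\<rho> 3 = \<rho> 1" using rho_add_2[of 1] n by simp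
  show "\<sigma> 1 \<otimes> \<rho> 1 = \<rho> 1 \<otimes> \<sigma> 1"
    using mixed_far[OF i(1) i(3)] by (simp add: far_def r3)
  have m1: "\<rho> 1 \<otimes> (\<rho> 2 \<otimes> \<sigma> 1) = \<sigma> 2 \<otimes> (\<rho> 1 \<otimes> \<rho> 2)"
    using mixed_braid[OF i(4)] by simp
  have m2: "\<rho> 2 \<otimes> (\<rho> 1 \<otimes> \<sigma> 2) = \<sigma> 3 \<otimes> (\<rho> 2 \<otimes> \<rho> 1)"
    using mixed_braid[OF i(5)] by (simp add: r3)
  have "\<sigma> 1 = \<rho> 2 \<otimes> (\<rho> 1 \<otimes> (\<rho> 1 \<otimes> (\<rho> 2 \<otimes> \<sigma> 1)))" by simp
  also have "\<dots> = (\<rho> 2 \<otimes> (\<rho> 1 \<otimes> \<sigma> 2)) \<otimes> (\<rho> 1 \<otimes> \<rho> 2)"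
    unfolding m1 by (simp add: m_assoc)
  also have "\<dots> = \<sigma> 3" unfolding m2 by (simp add: m_assoc)
  finally show "\<sigma> 3 = \<sigma> 1" by simp
qed

end

section \<open>Passing to the metabelian quotients and identifying their derived subgroups\<close>

abbreviation VB_mod :: "nat \<Rightarrow> vb_gen word set set monoid" where
  "VB_mod n \<equiv> VB n Mod VB_derived2 n"

abbreviation sigma_mod :: "nat \<Rightarrow> nat \<Rightarrow> vb_gen word set set" where
  "sigma_mod n i \<equiv> VB_derived2 n #>\<^bsub>VB n\<^esub> VB_class n [sg i]"

abbreviation rho_mod :: "nat \<Rightarrow> nat \<Rightarrow> vb_gen word set set" where
  "rho_mod n i \<equiv> VB_derived2 n #>\<^bsub>VB n\<^esub> VB_class n [rh i]"

lemma VB_derived2_normal: "VB_derived2 n \<lhd> VB n"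
  unfolding VB_derived2_def VB_derived_def
  by (rule group.derived_Mod_eq_derived_metabelian(1)[OF group_VB])

lemma VB_derived_quot_eq:
  "VB_derived_quot n = (VB_mod n)\<lparr>carrier := derived (VB_mod n) (carrier (VB_mod n))\<rparr>"
  unfolding VB_derived_quot_def VB_derived2_def VB_derived_def
  by (rule group.derived_Mod_eq_derived_metabelian(2)[OF group_VB])

lemma metabelian_vb_VB_mod: "metabelian_vb (VB_mod n) n (sigma_mod n) (rho_mod n)"
proof -
  interpret V: vb_generators "VB n" n "\<lambda>i. VB_class n [sg i]" "\<lambda>i. VB_class n [rh i]"
    by (rule vb_generators_VB)
  interpret M: vb_generators "VB_mod n" n "sigma_mod n" "rho_mod n"
    by (rule V.vb_generators_Mod[OF VB_derived2_normal])
  show ?thesis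
    by unfold_locales
      (use group.derived_Mod_eq_derived_metabelian(3)[OF group_VB, of _ n] in
        \<open>simp add: VB_derived2_def VB_derived_def\<close>)
qed

text \<open>Supplies the detecting homomorphisms: \<open>v\<close> prescribes the image of
  \<sigma>_1 and \<open>u\<close> that of \<rho>_1 \<rho>_2.\<close>

lemma VB_mod_hom_signed_shift:
  fixes u v :: "int \<Rightarrow> 'a::ab_group_add"
  assumes "n \<in> {3, 4}" and v: "n = 4 \<Longrightarrow> v = (\<lambda>_. 0)"
    and three: "\<And>j. u j + u j + u j = 0"
    and rec: "\<And>j. u (j + 3) = u j + u (j + 1) - u (j + 2)"
  obtains h where "h \<in> hom (VB_mod n) signed_shift"
    and "h (sigma_mod n 1) = (v, 1, False)" and "h (rho_mod n 1) = (\<lambda>_. 0, 0, True)"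
    and "h (rho_mod n 1 \<otimes>\<^bsub>VB_mod n\<^esub> rho_mod n 2) = (u, 0, False)"
proof -
  have i: "1 \<in> {1..n-1}" "2 \<in> {1..n-1}" using assms(1) by auto
  interpret V: vb_generators "VB n" n "\<lambda>i. VB_class n [sg i]" "\<lambda>i. VB_class n [rh i]"
    by (rule vb_generators_VB)
  interpret M: metabelian_vb "VB_mod n" n "sigma_mod n" "rho_mod n"
    by (rule metabelian_vb_VB_mod)
  have "n \<le> 4" using assms(1) by auto
  obtain h0 where h0: "h0 \<in> hom (VB n) signed_shift"
    "\<And>i. i \<in> {1..n-1} \<Longrightarrow> h0 (VB_class n [sg i])
      = (if odd i then (v, 1, False) else (\<lambda>j. u j + v j - u (j + 1), 1, False))"
    "\<And>i. i \<in> {1..n-1} \<Longrightarrow> h0 (VB_class n [rh i])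
      = (if odd i then (\<lambda>_. 0, 0, True) else (\<lambda>j. - u j, 0, True))"
    by (rule vb_relations.VB_hom[OF vb_relations_signed_shift[OF \<open>n \<le> 4\<close> v three rec]])
      (assumption, rule that)
  obtain h where h: "h \<in> hom (VB_mod n) signed_shift"
    "\<And>x. x \<in> carrier (VB n) \<Longrightarrow> h (VB_derived2 n #>\<^bsub>VB n\<^esub> x) = h0 x"
    using V.signed_shift_hom_Mod[OF h0(1)] unfolding VB_derived2_def VB_derived_def by blast
  have v1: "h (sigma_mod n 1) = (v, 1, False)" "h (rho_mod n 1) = (\<lambda>_. 0, 0, True)"
    "h (rho_mod n 2) = (\<lambda>j. - u j, 0, True)"
    using h(2)[OF V.sigma_closed[OF i(1)]] h(2)[OF V.rho_closed[OF i(1)]] h(2)[OF V.rho_closed[OF i(2)]]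
      h0(2)[OF i(1)] h0(3)[OF i(1)] h0(3)[OF i(2)]
    by simp_all
  have "h (rho_mod n 1 \<otimes>\<^bsub>VB_mod n\<^esub> rho_mod n 2) = (u, 0, False)"
    using hom_mult[OF h(1) M.rho_closed[OF i(1)] M.rho_closed[OF i(2)]] by (simp add: v1 del: One_nat_def)
  then show thesis using that[OF h(1) v1(1,2)] by simp
qed

text \<open>The conjugates of \<open>d\<close> are indexed by integers, the summands of
  \<open>Z_infinity\<close> by naturals; a bijection of the index sets suffices.\<close>

lemma Z_infinity_iso: "free_Abelian_group (UNIV :: int set) \<cong> Z_infinity"
proof -
  have "Z_infinity \<cong> free_Abelian_group (UNIV :: nat set)"
    unfolding Z_infinity_def by (rule isomorphic_sum_integer_group)
  also have "\<dots> \<cong> free_Abelian_group (UNIV :: int set)"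
    unfolding isomorphic_free_Abelian_groups eqpoll_def using bij_int_decode by blast
  finally have "Z_infinity \<cong> free_Abelian_group (UNIV :: int set)" .
  moreover have "group Z_infinity" unfolding Z_infinity_def by simp
  ultimately show ?thesis by (rule group.iso_sym[rotated])
qed

lemma VB_derived_quot_3: "VB_derived_quot 3 \<cong> Z3 \<times>\<times> Z3 \<times>\<times> Z3 \<times>\<times> Z_infinity"
proof -
  interpret M: metabelian_vb "VB_mod 3" 3 "sigma_mod 3" "rho_mod 3"
    by (rule metabelian_vb_VB_mod)
  have "i = 1 \<or> i = 2" if "i \<in> {1..3 - 1}" for i :: nat using that by auto
  then interpret T: metabelian_triple "VB_mod 3" "sigma_mod 3 1" "rho_mod 3 1"
    "rho_mod 3 1 \<otimes>\<^bsub>VB_mod 3\<^esub> rho_mod 3 2"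
    by (intro M.metabelian_tripleI) auto
  obtain h1 where h1: "h1 \<in> hom (VB_mod 3) signed_shift"
    "h1 (sigma_mod 3 1) = (\<lambda>_. 0, 1, False)" "h1 (rho_mod 3 1) = (\<lambda>_. 0, 0, True)"
    "h1 (rho_mod 3 1 \<otimes>\<^bsub>VB_mod 3\<^esub> rho_mod 3 2) = (hexaperiodic, 0, False)"
    by (rule VB_mod_hom_signed_shift[of 3 "\<lambda>_. 0" hexaperiodic])
      (use three_eq_0 hexaperiodic_recurrence in auto)
  obtain h2 where h2: "h2 \<in> hom (VB_mod 3) signed_shift"
    "h2 (sigma_mod 3 1) = (\<lambda>j. if j = 0 then 1 else 0 :: int, 1, False)"
    "h2 (rho_mod 3 1) = (\<lambda>_. 0, 0, True)"
    "h2 (rho_mod 3 1 \<otimes>\<^bsub>VB_mod 3\<^esub> rho_mod 3 2) = (\<lambda>_. 0, 0, False)"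
    \<comment> \<open>Over \<int> the condition on \<open>u\<close> leaves only 0, while on three
      strands \<open>v\<close> is free; the delta function makes its translates independent.\<close>
    by (rule VB_mod_hom_signed_shift[of 3 "\<lambda>j. if j = 0 then 1 else 0 :: int" "\<lambda>_. 0"]) simp_all
  have "VB_derived_quot 3 \<cong> Z3 \<times>\<times> Z3 \<times>\<times> Z3 \<times>\<times> free_Abelian_group (UNIV :: int set)"
    using T.H_iso_times_free[OF h1 h2] unfolding VB_derived_quot_eq T.H_def T.D_def .
  also have "\<dots> \<cong> Z3 \<times>\<times> Z3 \<times>\<times> Z3 \<times>\<times> Z_infinity"
    by (intro group.DirProd_iso_trans Z_infinity_iso iso_refl group_integer_mod_group)
  finally show ?thesis .
qed

lemma VB_derived_quot_4: "VB_derived_quot 4 \<cong> Z3 \<times>\<times> Z3 \<times>\<times> Z3"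
proof -
  interpret M: metabelian_vb "VB_mod 4" 4 "sigma_mod 4" "rho_mod 4"
    by (rule metabelian_vb_VB_mod)
  note four = M.four_strands[OF HOL.refl]
  have "i = 1 \<or> i = 2 \<or> i = 3" if "i \<in> {1..4 - 1}" for i :: nat using that by auto
  then interpret T: metabelian_triple "VB_mod 4" "sigma_mod 4 1" "rho_mod 4 1"
    "rho_mod 4 1 \<otimes>\<^bsub>VB_mod 4\<^esub> rho_mod 4 2"
    using four(1,2) by (intro M.metabelian_tripleI) auto
  obtain h1 where h1: "h1 \<in> hom (VB_mod 4) signed_shift"
    "h1 (sigma_mod 4 1) = (\<lambda>_. 0, 1, False)" "h1 (rho_mod 4 1) = (\<lambda>_. 0, 0, True)"
    "h1 (rho_mod 4 1 \<otimes>\<^bsub>VB_mod 4\<^esub> rho_mod 4 2) = (hexaperiodic, 0, False)"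
    by (rule VB_mod_hom_signed_shift[of 4 "\<lambda>_. 0" hexaperiodic])
      (use three_eq_0 hexaperiodic_recurrence in auto)
  have "T.d = \<one>\<^bsub>VB_mod 4\<^esub>"
    using M.commutator_eq_one_iff[OF T.closed(1,2)] four(3) unfolding T.d_def T.inv_r by blast
  then show ?thesis
    using T.H_iso_Z3_cubed[OF h1(1,2,4)] unfolding VB_derived_quot_eq T.H_def T.D_def by blast
qed

text \<open>For these \<open>n\<close> the quotient by \<open>VB_derived2 n\<close> is abelian, so
  that subgroup already contains every commutator.\<close>

lemma VB_derived_perfect:
  assumes "n \<ge> 5"
  shows "VB_derived n = VB_derived2 n"
proof
  interpret V: group "VB n" by (rule group_VB)
  interpret M: metabelian_vb "VB_mod n" n "sigma_mod n" "rho_mod n"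
    by (rule metabelian_vb_VB_mod)
  show "VB_derived n \<subseteq> VB_derived2 n"
    unfolding VB_derived_def
    by (rule V.derived_minimal[OF VB_derived2_normal M.comm_group_if_5_le[OF assms]])
  show "VB_derived2 n \<subseteq> VB_derived n"
    unfolding VB_derived2_def VB_derived_def
    by (rule V.derived_incl[OF _ V.derived_is_subgroup]) simp_all
qed

theorem corollary1p2:
  shows "VB_derived_quot 3 \<cong> Z3 \<times>\<times> Z3 \<times>\<times> Z3 \<times>\<times> Z_infinity
    \<and> VB_derived_quot 4 \<cong> Z3 \<times>\<times> Z3 \<times>\<times> Z3
    \<and> (\<forall>n\<ge>5. VB_derived n = VB_derived2 n)"
  by (intro conjI allI impI VB_derived_quot_3 VB_derived_quot_4 VB_derived_perfect)

end
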